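(* Let $G=T\cup C$ be a tree-union-cycle graph that is not a wheel, and let $\{\mathcal{L}_u\}_{u\in V(G)}$ be the collection of L-shapes constructed from $G$ as in the context. Then $\{\mathcal{L}_u\}_{u\in V(G)}$ forms a valid one-bend VPG representation of $G$: for all distinct $u,v\in V(G)$, $uv\in E(G)$ if and only if $\mathcal{L}_u\cap\mathcal{L}_v\neq\emptyset$.
   Context: A tree-union-cycle graph is a simple planar graph $G=T\cup C$, where $T$ is a tree and $C$ is a simple cycle induced by all the leaves of $T$. Write $C=c_0c_1\dots c_{k-1}c_0$, indices modulo $k$. Let $S=V(G)\setminus V(C)$ be the set of internal vertices of $T$; $G$ is not a wheel, i.e. $S$ is not a singleton. For $x,y\in V(T)$, $xTy$ denotes the path in $T$ between $x$ and $y$. When $T$ is rooted at a vertex $s\in S$: $h^s(u)$ is the length of the path $sTu$; $u$ is an ancestor of $v$ (and $v$ a descendant of $u$) if $u$ lies on $sTv$; $L^s(u)$ is the set of leaves of $T$ that are descendants of $u$ (with $L^s(u)=\{u\}$ if $u$ is a leaf); $hca(u,v)$ is the vertex of $uTv$ with smallest value of $h^s$. L-shapes: $$\mathcal{L}([x_1,x_2],[y_1,y_2])=\{(x,y): x=x_1,\ y\in[y_1,y_2]\}\cup\{(x,y): y=y_1,\ x\in[x_1,x_2]\}.$$ (The interval $[x_1,x_2]$ may be a single point.) Construction. Root $T$ at a vertex $r\in S$. Let $c_i,c_{i+1}$ be two consecutive leaves on $C$ such that all the internal vertices except one on the path $c_iTc_{i+1}$ are of degree two (such an index $i$ exists). Put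 $r'=hca(c_i,c_{i+1})$ (computed with respect to the root $r$), and let $b_j=c_{(i+j)\bmod k}$ for $0\le j\le k-1$. Now take $r'$ as the new root of $T$ and let $h=\max\{h^{r'}(u): u\in V(G)\}$. For a vertex $w$ with $\mathcal{L}_w=\mathcal{L}([x_1,x_2],[y_1,y_2])$ write $l_x(w)=x_1$. Define: - $\mathcal{L}_{b_0}=\mathcal{L}([1.5,\,k-1],[0,\,h-h^{r'}(b_0)+2])$; - $\mathcal{L}_{b_1}=\mathcal{L}([1,2],[1,\,h-h^{r'}(b_1)+2])$; - $\mathcal{L}_{b_{k-1}}=\mathcal{L}([k-1,k],[0,\,h-h^{r'}(b_{k-1})+2])$; - $\mathcal{L}_{b_j}=\mathcal{L}([j,j+1],[1,\,h-h^{r'}(b_j)+2])$ for every leaf $b_j$ other than $b_0,b_1,b_{k-1}$; - for every internal vertex $v\in S$, $\mathcal{L}_v=\mathcal{L}\big([\min\{l_x(w): w\in L^{r'}(v)\},\ \max\{l_x(w): w\in L^{r'}(v)\}],\ [h-h^{r'}(v)+1,\ h-h^{r'}(v)+2]\big)$.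
   Formalization: Adds that every vertex strictly between r' and c_{i+1} on the path in T has degree two; otherwise it fails: k=3, T-edges c_0r, rb, bc_1, bc_2, i=0 gives r'=r, and the L-shapes of c_0 and b meet at (1.5,2) although c_0b is not an edge. *)

theory Defs
  imports "HOL-Analysis.Analysis"
begin

definition simple_graph :: "'a set \<Rightarrow> 'a set set \<Rightarrow> bool" where
  "simple_graph V E \<longleftrightarrow> finite V \<and> (\<forall>e\<in>E. e \<subseteq> V \<and> card e = 2)"

definition degree :: "'a set set \<Rightarrow> 'a \<Rightarrow> nat" where
  "degree E v = card {e \<in> E. v \<in> e}"

definition is_path :: "'a set set \<Rightarrow> 'a \<Rightarrow> 'a list \<Rightarrow> 'a \<Rightarrow> bool" where
  "is_path E x p y \<longleftrightarrow> p \<noteq> [] \<and> hd p = x \<and> last p = y \<and> distinct p \<and>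
     (\<forall>j. Suc j < length p \<longrightarrow> {p ! j, p ! Suc j} \<in> E)"

definition cycle_edges :: "'a list \<Rightarrow> 'a set set" where
  "cycle_edges cs = {{cs ! j, cs ! (Suc j mod length cs)} |j. j < length cs}"

definition is_cycle :: "'a set set \<Rightarrow> 'a list \<Rightarrow> bool" where
  "is_cycle E cs \<longleftrightarrow> length cs \<ge> 3 \<and> distinct cs \<and> cycle_edges cs \<subseteq> E"

definition tree :: "'a set \<Rightarrow> 'a set set \<Rightarrow> bool" where
  "tree V E \<longleftrightarrow> simple_graph V E \<and> V \<noteq> {} \<and>
     (\<forall>x\<in>V. \<forall>y\<in>V. \<exists>p. set p \<subseteq> V \<and> is_path E x p y) \<and>
     (\<nexists>cs. is_cycle E cs)"

definition leaves :: "'a set \<Rightarrow> 'a set set \<Rightarrow> 'a set" where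
  "leaves V E = {v \<in> V. degree E v = 1}"

text \<open>Planarity is the existence of a topological drawing in the plane: vertices are distinct
  points, edges are arcs joining their end vertices, and an edge meets a vertex point or
  another edge only at common end vertices.\<close>

definition planar :: "'a set \<Rightarrow> 'a set set \<Rightarrow> bool" where
  "planar V E \<longleftrightarrow>
     (\<exists>(pos :: 'a \<Rightarrow> complex) (\<gamma> :: 'a set \<Rightarrow> real \<Rightarrow> complex).
        inj_on pos V \<and>
        (\<forall>e\<in>E. arc (\<gamma> e) \<and> {pathstart (\<gamma> e), pathfinish (\<gamma> e)} = pos ` e \<and>
               path_image (\<gamma> e) \<inter> pos ` V = pos ` e) \<and>
        (\<forall>e\<in>E. \<forall>f\<in>E. e \<noteq> f \<longrightarrow> path_image (\<gamma> e) \<inter> path_image (\<gamma> f) \<subseteq> pos ` (e \<inter> f)))"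

text \<open>\<open>(V, E)\<close> is the graph \<open>G\<close>, \<open>ET\<close> is the edge set of the spanning tree \<open>T\<close>, and the list \<open>cs\<close>
  is the labelling \<open>c\<^sub>0, \<dots>, c\<^sub>k\<^sub>-\<^sub>1\<close> of the cycle \<open>C\<close>.\<close>

definition tree_union_cycle :: "'a set \<Rightarrow> 'a set set \<Rightarrow> 'a set set \<Rightarrow> 'a list \<Rightarrow> bool" where
  "tree_union_cycle V E ET cs \<longleftrightarrow>
     simple_graph V E \<and> planar V E \<and> tree V ET \<and> is_cycle E cs \<and>
     E = ET \<union> cycle_edges cs \<and>
     set cs = leaves V ET \<and>
     {e \<in> E. e \<subseteq> leaves V ET} = cycle_edges cs"

definition cyc :: "'a list \<Rightarrow> nat \<Rightarrow> 'a" where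
  "cyc cs j = cs ! (j mod length cs)"

definition tpath :: "'a set set \<Rightarrow> 'a \<Rightarrow> 'a \<Rightarrow> 'a list" where
  "tpath ET x y = (THE p. is_path ET x p y)"

definition height :: "'a set set \<Rightarrow> 'a \<Rightarrow> 'a \<Rightarrow> nat" where
  "height ET s u = length (tpath ET s u) - 1"

definition ancestor :: "'a set set \<Rightarrow> 'a \<Rightarrow> 'a \<Rightarrow> 'a \<Rightarrow> bool" where
  "ancestor ET s u v \<longleftrightarrow> u \<in> set (tpath ET s v)"

definition leaves_below :: "'a set \<Rightarrow> 'a set set \<Rightarrow> 'a \<Rightarrow> 'a \<Rightarrow> 'a set" where
  "leaves_below V ET s u = {w \<in> leaves V ET. ancestor ET s u w}"

definition hca :: "'a set set \<Rightarrow> 'a \<Rightarrow> 'a \<Rightarrow> 'a \<Rightarrow> 'a" where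
  "hca ET s u v = arg_min_on (height ET s) (set (tpath ET u v))"

definition inner_vertices :: "'a set set \<Rightarrow> 'a \<Rightarrow> 'a \<Rightarrow> 'a set" where
  "inner_vertices ET x y = set (tpath ET x y) - {x, y}"

definition good_pair :: "'a set set \<Rightarrow> 'a list \<Rightarrow> nat \<Rightarrow> bool" where
  "good_pair ET cs i \<longleftrightarrow>
     (\<exists>v \<in> inner_vertices ET (cyc cs i) (cyc cs (i + 1)).
        \<forall>w \<in> inner_vertices ET (cyc cs i) (cyc cs (i + 1)) - {v}. degree ET w = 2)"

definition new_root :: "'a set set \<Rightarrow> 'a list \<Rightarrow> 'a \<Rightarrow> nat \<Rightarrow> 'a" where
  "new_root ET cs r i = hca ET r (cyc cs i) (cyc cs (i + 1))"

text \<open>The exceptional vertex of the path from \<open>c\<^sub>i\<close> to \<open>c\<^sub>i\<^sub>+\<^sub>1\<close> (the only one of degree at least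
  three) is meant to be the new root \<open>r'\<close>.  This can fail only if \<open>r\<close> itself is a vertex of degree
  two on that path, whence \<open>r' = r\<close>.  If moreover \<open>r\<close> lies between \<open>c\<^sub>i\<close> and the exceptional
  vertex, the construction does not represent \<open>G\<close>: the child of \<open>r'\<close> towards \<open>c\<^sub>i\<close> has its vertical
  segment at \<open>x = 1.5\<close> and crosses the horizontal segment of the other child, which spans
  \<open>[1, k - 1]\<close>.  The smallest example has \<open>k = 3\<close> and tree edges
  \<open>c\<^sub>0 r, r b, b c\<^sub>1, b c\<^sub>2\<close>, with \<open>i = 0\<close>.  The next condition excludes precisely these
  choices of \<open>r\<close> and \<open>i\<close>; it holds whenever \<open>r'\<close> is the exceptional vertex.\<close>

definition root_admissible :: "'a set set \<Rightarrow> 'a list \<Rightarrow> 'a \<Rightarrow> nat \<Rightarrow> bool" where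
  "root_admissible ET cs r i \<longleftrightarrow>
     (\<forall>w \<in> inner_vertices ET (new_root ET cs r i) (cyc cs (i + 1)). degree ET w = 2)"

type_synonym box = "(real \<times> real) \<times> (real \<times> real)"

fun L_shape :: "box \<Rightarrow> (real \<times> real) set" where
  "L_shape ((x1, x2), (y1, y2)) =
     {(x, y). x = x1 \<and> y \<in> {y1..y2}} \<union> {(x, y). y = y1 \<and> x \<in> {x1..x2}}"

definition tree_height :: "'a set \<Rightarrow> 'a set set \<Rightarrow> 'a \<Rightarrow> nat" where
  "tree_height V ET s = Max (height ET s ` V)"

text \<open>The number \<open>j < k\<close> with \<open>w = b\<^sub>j = c\<^sub>i\<^sub>+\<^sub>j\<close>.\<close>

definition leaf_index :: "'a list \<Rightarrow> nat \<Rightarrow> 'a \<Rightarrow> nat" where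
  "leaf_index cs i w = (THE j. j < length cs \<and> w = cyc cs (i + j))"

text \<open>In the following, \<open>s\<close> is the new root \<open>r'\<close>.\<close>

definition leaf_box :: "'a set \<Rightarrow> 'a set set \<Rightarrow> 'a list \<Rightarrow> 'a \<Rightarrow> nat \<Rightarrow> 'a \<Rightarrow> box" where
  "leaf_box V ET cs s i w =
     (let k = real (length cs);
          j = leaf_index cs i w;
          top = real (tree_height V ET s) - real (height ET s w) + 2
      in if j = 0 then ((3/2, k - 1), (0, top))
         else if j = 1 then ((1, 2), (1, top))
         else if j = length cs - 1 then ((k - 1, k), (0, top))
         else ((real j, real j + 1), (1, top)))"

definition leaf_x :: "'a set \<Rightarrow> 'a set set \<Rightarrow> 'a list \<Rightarrow> 'a \<Rightarrow> nat \<Rightarrow> 'a \<Rightarrow> real" where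
  "leaf_x V ET cs s i w = fst (fst (leaf_box V ET cs s i w))"

definition inner_box :: "'a set \<Rightarrow> 'a set set \<Rightarrow> 'a list \<Rightarrow> 'a \<Rightarrow> nat \<Rightarrow> 'a \<Rightarrow> box" where
  "inner_box V ET cs s i v =
     (let xs = leaf_x V ET cs s i ` leaves_below V ET s v;
          y = real (tree_height V ET s) - real (height ET s v) + 1
      in ((Min xs, Max xs), (y, y + 1)))"

definition L_rep :: "'a set \<Rightarrow> 'a set set \<Rightarrow> 'a list \<Rightarrow> 'a \<Rightarrow> nat \<Rightarrow> 'a \<Rightarrow> (real \<times> real) set" where
  "L_rep V ET cs r i u =
     (let s = new_root ET cs r i
      in L_shape (if u \<in> set cs then leaf_box V ET cs s i u else inner_box V ET cs s i u))"

definition valid_VPG_rep :: "'a set \<Rightarrow> 'a set set \<Rightarrow> ('a \<Rightarrow> (real \<times> real) set) \<Rightarrow> bool" where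
  "valid_VPG_rep V E L \<longleftrightarrow>
     (\<forall>u\<in>V. \<forall>v\<in>V. u \<noteq> v \<longrightarrow> ({u, v} \<in> E \<longleftrightarrow> L u \<inter> L v \<noteq> {}))"

end

(* Since S is connected and avoids C, every tree edge cuts the leaves into two arcs of C: otherwise
   two disjoint tree paths joining interlaced pairs of leaves, linked by a third one, would form with
   C a subdivision of K_{3,3}.  The choice of c_i, c_{i+1} makes all other leaves hang off a single
   vertex x of the path between them, with r' between x and c_{i+1}.  Hence, apart from r', a vertex
   above b_1 has no other leaf below it, and a vertex above b_0 has below it either b_0 alone or all
   leaves but b_1; together with the arc property, the x-range of every internal vertex contains the
   abscissa of no leaf outside its subtree.  Two internal shapes whose x-ranges meet thus belong to
   comparable vertices, and the heights leave only parent and child. *)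
theory Submission
  imports Defs
begin

section \<open>Theta curves and plane drawings\<close>

text \<open>The horizontal segments of the leaves realise the cycle: for
  \<open>0 < j < k - 1\<close> the foot of \<open>b j\<close>, at height 1, ends on the vertical
  segment of \<open>b (j + 1)\<close>. To close the cycle, \<open>b 0\<close> stands at 3/2, inside
  the foot [1, 2] of \<open>b 1\<close>, and its own foot runs at height 0 under the other leaves to
  \<open>b (k - 1)\<close>. The price is the order of the leaves from left to right,
  \<open>b 1\<close>, \<open>b 0\<close>, \<open>b 2\<close>, ..., \<open>b (k - 1)\<close>, which
  is not the cyclic order cut open. An arc of the cycle need not be an interval of this order: the
  range of \<open>b 1\<close> and \<open>b 2\<close> would capture \<open>b 0\<close>, and that of
  \<open>b (k - 1)\<close> and \<open>b 0\<close> would capture \<open>b 2\<close> if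
  \<open>k > 3\<close>. So arcs alone do not suffice, and the choice of \<open>i\<close> and
  \<open>r\<close> has to exclude such subtrees. Planarity is needed only for subtrees that contain
  neither \<open>b 0\<close> nor \<open>b 1\<close>, where order by abscissa is order by index. It
  enters topologically: a connected set off a theta curve cannot touch all three of its
  arcs.\<close>

lemma Jordan_other_side:
  fixes c1 c2 :: "real \<Rightarrow> complex"
  assumes c1: "arc c1" "pathstart c1 = a" "pathfinish c1 = b"
    and c2: "arc c2" "pathstart c2 = a" "pathfinish c2 = b"
    and int: "path_image c1 \<inter> path_image c2 \<subseteq> {a, b}"
    and Y: "connected Y" "Y \<noteq> {}" "Y \<inter> (path_image c1 \<union> path_image c2) = {}"
  obtains D where "connected D" "D \<noteq> {}" "frontier D = path_image c1 \<union> path_image c2"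
    "\<And>x y. x \<in> D \<Longrightarrow> y \<in> Y \<Longrightarrow> \<not> connected_component (- (path_image c1 \<union> path_image c2)) x y"
    "D \<inter> Y = {}" "D \<inter> (path_image c1 \<union> path_image c2) = {}"
proof -
  let ?g = "c1 +++ reversepath c2"
  have sp: "simple_path ?g"
    by (rule simple_path_join_loop) (use c1 c2 int in \<open>auto simp: arc_reversepath\<close>)
  have closed: "pathfinish ?g = pathstart ?g"
    using c1 c2 by simp
  have im: "path_image ?g = path_image c1 \<union> path_image c2"
    using c1 c2 by (simp add: path_image_join)
  let ?J = "path_image c1 \<union> path_image c2"
  \<comment> \<open>Inside and outside are kept symmetric, because \<open>Y\<close> may lie in
    either of them.\<close>
  have "\<exists>D D'. {D, D'} = {inside ?J, outside ?J} \<and> Y \<subseteq> D'"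
  proof -
    have "Y \<subseteq> inside ?J \<union> outside ?J"
      using Jordan_inside_outside [OF sp closed] Y(3) unfolding im by blast
    moreover have "open (inside ?J)" "open (outside ?J)" "inside ?J \<inter> outside ?J = {}"
      using Jordan_inside_outside [OF sp closed] unfolding im by blast+
    ultimately have "inside ?J \<inter> Y = {} \<or> outside ?J \<inter> Y = {}"
      using connectedD [OF Y(1)] by blast
    then show ?thesis
      using \<open>Y \<subseteq> inside ?J \<union> outside ?J\<close> by blast
  qed
  then obtain D D' where DD: "{D, D'} = {inside ?J, outside ?J}" "Y \<subseteq> D'"
    by blast
  then have D: "open D" "connected D" "D \<noteq> {}" "frontier D = ?J" "open D'" "D \<inter> D' = {}"
      "D \<union> D' = - ?J"
  proof -
    have "(D = inside ?J \<and> D' = outside ?J) \<or> (D = outside ?J \<and> D' = inside ?J)"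
      using DD(1) by (simp add: doubleton_eq_iff)
    then show "open D" "connected D" "D \<noteq> {}" "frontier D = ?J" "open D'" "D \<inter> D' = {}"
        "D \<union> D' = - ?J"
      using Jordan_inside_outside [OF sp closed] unfolding im by (metis Int_commute Un_commute)+
  qed
  have "\<not> connected_component (- ?J) x y" if "x \<in> D" "y \<in> Y" for x y
  proof
    assume "connected_component (- ?J) x y"
    then obtain T where "connected T" "T \<subseteq> - ?J" "x \<in> T" "y \<in> T"
      unfolding connected_component_def by blast
    then show False
      using connectedD [of T D D'] D DD(2) that by blast
  qed
  with that D DD(2) show ?thesis
    by blast
qed

text \<open>Adding to \<open>A\<close> a limit point that lies in \<open>B\<close> keeps it
  connected and gives the two sets a common point.\<close>

lemma connected_Un_closure:
  assumes "connected A" "connected B" "closure A \<inter> B \<noteq> {}"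
  shows "connected (A \<union> B)"
proof -
  obtain p where p: "p \<in> closure A" "p \<in> B"
    using assms(3) by blast
  have "connected (insert p A)"
    using connected_intermediate_closure [OF assms(1), of "insert p A"] p closure_subset by blast
  then have "connected (insert p A \<union> B)"
    using assms(2) p by (intro connected_Un) auto
  moreover have "insert p A \<union> B = A \<union> B"
    using p by blast
  ultimately show ?thesis
    by simp
qed

text \<open>Let \<open>D\<close> be the side of the Jordan curve \<open>c1 \<union> c2\<close> that contains neither \<open>c3\<close> nor \<open>X\<close>.
  Points of \<open>D\<close> and \<open>X\<close> are joined off \<open>c1 \<union> c3\<close> (through \<open>c2\<close>) and off \<open>c2 \<union> c3\<close> (through \<open>c1\<close>),
  so by Janiszewski's theorem off all three arcs.\<close>

lemma theta_tripod:
  fixes c1 c2 c3 :: "real \<Rightarrow> complex"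
  assumes c1: "arc c1" "pathstart c1 = a" "pathfinish c1 = b"
    and c2: "arc c2" "pathstart c2 = a" "pathfinish c2 = b"
    and c3: "arc c3" "pathstart c3 = a" "pathfinish c3 = b"
    and i12: "path_image c1 \<inter> path_image c2 \<subseteq> {a, b}"
    and i13: "path_image c1 \<inter> path_image c3 \<subseteq> {a, b}"
    and i23: "path_image c2 \<inter> path_image c3 \<subseteq> {a, b}"
    and X: "connected X" "X \<inter> (path_image c1 \<union> path_image c2 \<union> path_image c3) = {}"
    and X1: "closure X \<inter> (path_image c1 - {a, b}) \<noteq> {}"
    and X2: "closure X \<inter> (path_image c2 - {a, b}) \<noteq> {}"
    and X3: "closure X \<inter> (path_image c3 - {a, b}) \<noteq> {}"
  shows False
proof -
  have con: "connected (X \<union> (path_image c - {a, b}))"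
    if "arc c" "pathstart c = a" "pathfinish c = b"
       "closure X \<inter> (path_image c - {a, b}) \<noteq> {}" for c
    using connected_simple_path_endless [OF arc_imp_simple_path [OF that(1)]] that X
    by (intro connected_Un_closure) auto
  have ab: "a \<in> path_image c1" "b \<in> path_image c1" "a \<in> path_image c2" "b \<in> path_image c2"
      "a \<in> path_image c3" "b \<in> path_image c3"
    using c1 c2 c3 pathstart_in_path_image pathfinish_in_path_image by metis+
  obtain u where u: "u \<in> X"
    using X1 by fastforce
  obtain D where D: "connected D" "D \<noteq> {}" "frontier D = path_image c1 \<union> path_image c2"
      "\<And>x y. x \<in> D \<Longrightarrow> y \<in> X \<union> (path_image c3 - {a, b}) \<Longrightarrow>
         \<not> connected_component (- (path_image c1 \<union> path_image c2)) x y"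
      "D \<inter> (X \<union> (path_image c3 - {a, b})) = {}" "D \<inter> (path_image c1 \<union> path_image c2) = {}"
    by (rule Jordan_other_side [OF c1 c2 i12 con [OF c3 X3]]) (use u X i13 i23 in blast)+
  obtain x where x: "x \<in> D"
    using D(2) by blast
  have clo: "path_image c1 \<union> path_image c2 \<subseteq> closure D"
    using D(3) by (auto simp: frontier_def)
  have "connected (D \<union> (X \<union> (path_image c2 - {a, b})))"
    by (rule connected_Un_closure [OF D(1) con [OF c2 X2]]) (use clo X2 in blast)
  moreover have "D \<union> (X \<union> (path_image c2 - {a, b})) \<subseteq> - (path_image c1 \<union> path_image c3)"
    using D(5,6) X(2) i12 i23 ab by blast
  ultimately have 13: "connected_component (- (path_image c1 \<union> path_image c3)) x u"
    using x u unfolding connected_component_def by blast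
  have "connected (D \<union> (X \<union> (path_image c1 - {a, b})))"
    by (rule connected_Un_closure [OF D(1) con [OF c1 X1]]) (use clo X1 in blast)
  moreover have "D \<union> (X \<union> (path_image c1 - {a, b})) \<subseteq> - (path_image c2 \<union> path_image c3)"
    using D(5,6) X(2) i12 i13 ab by blast
  ultimately have 23: "connected_component (- (path_image c2 \<union> path_image c3)) x u"
    using x u unfolding connected_component_def by blast
  \<comment> \<open>Janiszewski's theorem needs the two closed sets to have a connected
    intersection; here it is the single arc \<open>c3\<close>.\<close>
  have "(path_image c1 \<union> path_image c3) \<inter> (path_image c2 \<union> path_image c3) = path_image c3"
    using i12 ab by blast
  then have "connected_component (- ((path_image c1 \<union> path_image c3) \<union> (path_image c2 \<union> path_image c3))) x u"
    using c1(1) c2(1) c3(1)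
    by (intro Janiszewski [OF _ _ _ 13 23])
      (simp_all add: compact_arc_image closed_arc_image compact_Un closed_Un connected_arc_image
        del: Compl_Un)
  then have "connected_component (- (path_image c1 \<union> path_image c2)) x u"
    by (rule connected_component_of_subset) auto
  then show False
    using D(4) x u by blast
qed


text \<open>The truncated arc is the image of \<open>{0..<1}\<close>, whose closure contains 1. It
  serves as a leg that stays off a theta curve and still touches it in the closure.\<close>

lemma connected_arc_minus_finish:
  fixes g :: "real \<Rightarrow> 'a::t2_space"
  assumes "arc g"
  shows "connected (path_image g - {pathfinish g})"
    and "pathfinish g \<in> closure (path_image g - {pathfinish g})"
proof -
  have inj: "inj_on g {0..1}" and con: "continuous_on {0..1} g"
    using assms by (auto simp: arc_def path_def)
  have eq: "path_image g - {pathfinish g} = g ` {0..<1}"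
  proof
    show "path_image g - {pathfinish g} \<subseteq> g ` {0..<1}"
      by (auto simp: path_image_def pathfinish_def order_less_le)
    show "g ` {0..<1} \<subseteq> path_image g - {pathfinish g}"
      using inj_onD [OF inj, of _ 1] by (force simp: path_image_def pathfinish_def)
  qed
  show "connected (path_image g - {pathfinish g})"
    unfolding eq by (rule connected_continuous_image [OF continuous_on_subset [OF con]]) auto
  have "g ` closure {0..<1} \<subseteq> closure (g ` {0..<1})"
    using con by (intro image_closure_subset) (auto intro: closure_subset [THEN subsetD])
  then show "pathfinish g \<in> closure (path_image g - {pathfinish g})"
    unfolding eq by (auto simp: pathfinish_def)
qed

text \<open>A recursive counterpart of the indexed condition in \<open>is_path\<close>, suited to
  cutting, reversing and gluing paths by induction on the list.\<close>

fun path_edges :: "'a list \<Rightarrow> 'a set set" where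
  "path_edges (x # y # p) = insert {x, y} (path_edges (y # p))"
| "path_edges _ = {}"

lemma path_edges_subset_iff:
  "path_edges p \<subseteq> E \<longleftrightarrow> successively (\<lambda>x y. {x, y} \<in> E) p"
  by (induction p rule: path_edges.induct) auto

lemma is_path_iff:
  "is_path E x p y \<longleftrightarrow> p \<noteq> [] \<and> hd p = x \<and> last p = y \<and> distinct p \<and> path_edges p \<subseteq> E"
  unfolding is_path_def path_edges_subset_iff successively_conv_nth by blast

lemma path_edges_subset_set: "e \<in> path_edges p \<Longrightarrow> e \<subseteq> set p"
  by (induction p rule: path_edges.induct) auto

lemma Union_path_edges: "length p \<ge> 2 \<Longrightarrow> \<Union> (path_edges p) = set p"
proof (induction p rule: path_edges.induct)
  case (1 x y p)
  then show ?case
    by (cases p) auto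
qed auto

text \<open>In a path without repetition only the first edge contains \<open>a\<close>. If that edge
  is \<open>{a, b}\<close>, then \<open>b\<close> is both the second and the last vertex.\<close>

lemma closing_edge_in_path:
  assumes "is_path E a p b" "{a, b} \<in> path_edges p"
  shows "set p = {a, b}"
proof -
  obtain p' where p: "p = a # p'" "distinct p" "last p = b"
    using assms(1) by (cases p) (auto simp: is_path_iff)
  obtain y p'' where p': "p' = y # p''"
    using assms(2) p by (cases p') auto
  have "a \<notin> e" if "e \<in> path_edges (y # p'')" for e
    using path_edges_subset_set [OF that] p p' by auto
  then have "b = y"
    using assms(2) p p' by (auto simp: doubleton_eq_iff)
  then have "p'' = []"
    using p p' last_in_set [of p''] by (auto split: if_splits)
  then show ?thesis
    using p p' by auto
qed

section \<open>From vertex lists to arcs in a plane drawing\<close>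

locale plane_drawing =
  fixes V :: "'a set" and E :: "'a set set"
    and pos :: "'a \<Rightarrow> complex" and \<gamma> :: "'a set \<Rightarrow> real \<Rightarrow> complex"
  assumes graph: "simple_graph V E"
    and inj: "inj_on pos V"
    and arc: "e \<in> E \<Longrightarrow> arc (\<gamma> e)"
    and ends: "e \<in> E \<Longrightarrow> {pathstart (\<gamma> e), pathfinish (\<gamma> e)} = pos ` e"
    and crossing: "\<lbrakk>e \<in> E; f \<in> E; e \<noteq> f\<rbrakk> \<Longrightarrow> path_image (\<gamma> e) \<inter> path_image (\<gamma> f) \<subseteq> pos ` (e \<inter> f)"
begin

text \<open>The trace of a one-vertex path is empty, not a point; hence the hypotheses
  \<open>x \<noteq> y\<close> where end points must belong to it.\<close>

definition trace :: "'a list \<Rightarrow> complex set" where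
  "trace p = (\<Union>e\<in>path_edges p. path_image (\<gamma> e))"

lemma edge_arc:
  assumes "{x, y} \<in> E"
  obtains g where "arc g" "pathstart g = pos x" "pathfinish g = pos y"
    "path_image g = path_image (\<gamma> {x, y})"
proof -
  have "{pathstart (\<gamma> {x, y}), pathfinish (\<gamma> {x, y})} = {pos x, pos y}"
    using ends [OF assms] by simp
  then consider "pathstart (\<gamma> {x, y}) = pos x" "pathfinish (\<gamma> {x, y}) = pos y"
    | "pathstart (\<gamma> {x, y}) = pos y" "pathfinish (\<gamma> {x, y}) = pos x"
    by (auto simp: doubleton_eq_iff)
  then show ?thesis
  proof cases
    case 1
    then show ?thesis
      using that [of "\<gamma> {x, y}"] arc [OF assms] by simp
  next
    case 2
    then show ?thesis
      using that [of "reversepath (\<gamma> {x, y})"] arc [OF assms] by (simp add: arc_reversepath)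
  qed
qed

lemma path_arc:
  assumes "is_path E x p y" "x \<noteq> y"
  obtains g where "arc g" "pathstart g = pos x" "pathfinish g = pos y" "path_image g = trace p"
proof -
  have "\<exists>g. arc g \<and> pathstart g = pos x \<and> pathfinish g = pos y \<and> path_image g = trace p"
    using assms
  proof (induction p arbitrary: x rule: path_edges.induct)
    case (1 u v p)
    have u: "u = x" "{x, v} \<in> E" "x \<notin> set (v # p)" and p: "is_path E v (v # p) y"
      using 1(2) by (auto simp: is_path_iff)
    obtain g1 where g1: "arc g1" "pathstart g1 = pos x" "pathfinish g1 = pos v"
        "path_image g1 = path_image (\<gamma> {x, v})"
      using edge_arc [OF u(2)] .
    show ?case
    proof (cases "v = y")
      case True
      then have "p = []"
        using p last_in_set [of p] by (auto simp: is_path_iff split: if_splits)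
      then show ?thesis
        using g1 True u(1) by (auto simp: trace_def)
    next
      case False
      obtain g2 where g2: "arc g2" "pathstart g2 = pos v" "pathfinish g2 = pos y"
          "path_image g2 = trace (v # p)"
        using 1(1) [OF p False] by blast
      \<comment> \<open>Later edges avoid \<open>x\<close>, so \<open>v\<close> is the only vertex
        that they can share with the first edge.\<close>
      have "path_image g1 \<inter> path_image g2 \<subseteq> {pos v}"
      proof
        fix z assume "z \<in> path_image g1 \<inter> path_image g2"
        then obtain f where f: "f \<in> path_edges (v # p)" "z \<in> path_image (\<gamma> f)"
            "z \<in> path_image (\<gamma> {x, v})"
          using g1 g2 unfolding trace_def by auto
        have "x \<notin> f" "f \<in> E"
          using path_edges_subset_set [OF f(1)] f(1) u(3) p by (auto simp: is_path_iff)
        then show "z \<in> {pos v}"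
          using crossing [OF u(2) \<open>f \<in> E\<close>] f by auto
      qed
      then have "arc (g1 +++ g2)"
        using g1 g2 by (intro arc_join) auto
      moreover have "path_image (g1 +++ g2) = trace (u # v # p)"
        using g1 g2 u(1) by (simp add: path_image_join trace_def)
      ultimately show ?thesis
        using g1 g2 by (intro exI [of _ "g1 +++ g2"]) auto
    qed
  next
    case ("2_2" v)
    then show ?case by (auto simp: is_path_iff)
  qed (auto simp: is_path_iff)
  then show ?thesis
    using that by blast
qed

lemma pos_in_trace:
  assumes "is_path E x p y" "x \<noteq> y" "w \<in> set p"
  shows "pos w \<in> trace p"
proof -
  have "length p \<ge> 2"
    using assms(1,2) by (cases p rule: path_edges.cases) (auto simp: is_path_iff)
  then obtain e where e: "e \<in> path_edges p" "w \<in> e"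
    using Union_path_edges assms(3) by blast
  then have "pos w \<in> {pathstart (\<gamma> e), pathfinish (\<gamma> e)}"
    using ends [of e] assms(1) by (auto simp: is_path_iff)
  then show ?thesis
    using e(1) pathstart_in_path_image [of "\<gamma> e"] pathfinish_in_path_image [of "\<gamma> e"]
    by (auto simp: trace_def)
qed

lemma trace_meet:
  assumes "path_edges p \<subseteq> E" "path_edges q \<subseteq> E" "path_edges p \<inter> path_edges q = {}"
  shows "trace p \<inter> trace q \<subseteq> pos ` (set p \<inter> set q)"
proof
  fix z assume "z \<in> trace p \<inter> trace q"
  then obtain e f where ef: "e \<in> path_edges p" "f \<in> path_edges q"
      "z \<in> path_image (\<gamma> e)" "z \<in> path_image (\<gamma> f)"
    by (auto simp: trace_def)
  then have "z \<in> pos ` (e \<inter> f)"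
    using assms crossing [of e f] by blast
  then show "z \<in> pos ` (set p \<inter> set q)"
    using path_edges_subset_set ef by blast
qed

lemma subset_V:
  assumes "is_path E x p y" "x \<noteq> y"
  shows "set p \<subseteq> V"
proof -
  have "length p \<ge> 2"
    using assms by (cases p rule: path_edges.cases) (auto simp: is_path_iff)
  then have "set p = \<Union> (path_edges p)"
    by (simp add: Union_path_edges)
  also have "\<dots> \<subseteq> V"
    using assms graph by (force simp: is_path_iff simple_graph_def)
  finally show ?thesis .
qed

text \<open>A common edge could only be \<open>{a, b}\<close>, and \<open>p\<close> cannot use it
  because it passes through a third vertex \<open>x\<close>.\<close>

lemma trace_meet_ends:
  assumes p: "is_path E a p b" "x \<in> set p" "x \<notin> {a, b}"
    and q: "is_path E a q b" "set p \<inter> set q \<subseteq> {a, b}"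
  shows "trace p \<inter> trace q \<subseteq> {pos a, pos b}"
proof -
  have "path_edges p \<inter> path_edges q = {}"
  proof (rule ccontr)
    assume "path_edges p \<inter> path_edges q \<noteq> {}"
    then obtain e where e: "e \<in> path_edges p" "e \<in> path_edges q"
      by blast
    then have "e \<subseteq> {a, b}" "card e = 2"
      using path_edges_subset_set q(2) p(1) graph by (blast, auto simp: is_path_iff simple_graph_def)
    then have "e = {a, b}"
      by (metis card_2_iff doubleton_eq_iff insert_subset insertE singletonD)
    then show False
      using closing_edge_in_path [OF p(1)] e p by blast
  qed
  then have "trace p \<inter> trace q \<subseteq> pos ` (set p \<inter> set q)"
    using p(1) q(1) by (intro trace_meet) (auto simp: is_path_iff)
  then show ?thesis
    using q(2) by blast
qed

lemma trace_meet_point: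
  assumes t: "is_path E q t x" and p: "is_path E a p b" and tp: "set t \<inter> set p \<subseteq> {x}"
  shows "trace t \<inter> trace p \<subseteq> {pos x}"
proof -
  have "path_edges t \<inter> path_edges p = {}"
  proof (rule ccontr)
    assume "path_edges t \<inter> path_edges p \<noteq> {}"
    then obtain e where e: "e \<in> path_edges t" "e \<in> path_edges p"
      by blast
    then have "e \<subseteq> {x}" "card e = 2"
      using path_edges_subset_set tp p graph by (blast, auto simp: is_path_iff simple_graph_def)
    then show False
      using card_mono [of "{x}" e] by simp
  qed
  then have "trace t \<inter> trace p \<subseteq> pos ` (set t \<inter> set p)"
    using t p by (intro trace_meet) (auto simp: is_path_iff)
  then show ?thesis
    using tp by blast
qed

text \<open>The two sides of K_{3,3} are \<open>a\<close>, \<open>b\<close>, \<open>q\<close> and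
  \<open>x1\<close>, \<open>x2\<close>, \<open>x3\<close>. The legs may overlap each other: only
  their union, a connected set off the theta curve, goes into \<open>theta_tripod\<close>. So three
  tree paths from a common root can be taken as they are.\<close>

lemma no_K33_subdivision:
  assumes p1: "is_path E a p1 b" and p2: "is_path E a p2 b" and p3: "is_path E a p3 b"
    and p12: "set p1 \<inter> set p2 \<subseteq> {a, b}" and p13: "set p1 \<inter> set p3 \<subseteq> {a, b}"
    and p23: "set p2 \<inter> set p3 \<subseteq> {a, b}"
    and x1: "x1 \<in> set p1" "x1 \<notin> {a, b}" and x2: "x2 \<in> set p2" "x2 \<notin> {a, b}"
    and x3: "x3 \<in> set p3" "x3 \<notin> {a, b}"
    and t1: "is_path E q t1 x1" and t2: "is_path E q t2 x2" and t3: "is_path E q t3 x3"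
    and t1p: "set t1 \<inter> (set p1 \<union> set p2 \<union> set p3) \<subseteq> {x1}"
    and t2p: "set t2 \<inter> (set p1 \<union> set p2 \<union> set p3) \<subseteq> {x2}"
    and t3p: "set t3 \<inter> (set p1 \<union> set p2 \<union> set p3) \<subseteq> {x3}"
    and q: "q \<notin> set p1 \<union> set p2 \<union> set p3"
  shows False
proof -
  have "a \<noteq> b"
  proof
    assume "a = b"
    then have "p1 = [a]"
      using p1 last_in_set [of "tl p1"] by (cases p1) (auto simp: is_path_iff split: if_splits)
    then show False
      using x1 \<open>a = b\<close> by auto
  qed
  have qx: "q \<noteq> x1" "q \<noteq> x2" "q \<noteq> x3"
    using q x1 x2 x3 by auto
  obtain c1 where c1: "arc c1" "pathstart c1 = pos a" "pathfinish c1 = pos b" "path_image c1 = trace p1"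
    using path_arc [OF p1 \<open>a \<noteq> b\<close>] .
  obtain c2 where c2: "arc c2" "pathstart c2 = pos a" "pathfinish c2 = pos b" "path_image c2 = trace p2"
    using path_arc [OF p2 \<open>a \<noteq> b\<close>] .
  obtain c3 where c3: "arc c3" "pathstart c3 = pos a" "pathfinish c3 = pos b" "path_image c3 = trace p3"
    using path_arc [OF p3 \<open>a \<noteq> b\<close>] .
  \<comment> \<open>Without its foot the leg is disjoint from the theta curve, and the foot remains
    in its closure.\<close>
  define leg where "leg t x = trace t - {pos x}" for t x
  have leg: "connected (leg t x)" "pos x \<in> closure (leg t x)" "pos q \<in> leg t x"
    if t: "is_path E q t x" "q \<noteq> x" for t x
  proof -
    obtain g where g: "arc g" "pathstart g = pos q" "pathfinish g = pos x" "path_image g = trace t"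
      using path_arc [OF t] .
    show "connected (leg t x)" "pos x \<in> closure (leg t x)"
      using connected_arc_minus_finish [OF g(1)] g by (simp_all add: leg_def)
    have "pos q \<noteq> pos x"
      using arc_distinct_ends [OF g(1)] g by simp
    then show "pos q \<in> leg t x"
      using g pathstart_in_path_image [of g] by (simp add: leg_def)
  qed
  define X where "X = leg t1 x1 \<union> leg t2 x2 \<union> leg t3 x3"
  note legs = leg [OF t1 qx(1)] leg [OF t2 qx(2)] leg [OF t3 qx(3)]
  have conX: "connected X"
    unfolding X_def using legs by (intro connected_Un) auto
  have clX: "pos x1 \<in> closure X" "pos x2 \<in> closure X" "pos x3 \<in> closure X"
    unfolding X_def using legs by auto
  have off: "leg t x \<inter> (trace p1 \<union> trace p2 \<union> trace p3) = {}"
    if "is_path E q t x" "set t \<inter> (set p1 \<union> set p2 \<union> set p3) \<subseteq> {x}" for t x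
    using trace_meet_point [OF that(1) p1] trace_meet_point [OF that(1) p2]
      trace_meet_point [OF that(1) p3] that(2) unfolding leg_def by blast
  have disj: "X \<inter> (path_image c1 \<union> path_image c2 \<union> path_image c3) = {}"
    unfolding X_def using off [OF t1 t1p] off [OF t2 t2p] off [OF t3 t3p] c1 c2 c3 by blast
  have "pos x \<in> trace p - {pos a, pos b}" if "is_path E a p b" "x \<in> set p" "x \<notin> {a, b}" for x p
  proof -
    have "{a, b, x} \<subseteq> V"
      using subset_V [OF that(1) \<open>a \<noteq> b\<close>] that by (auto simp: is_path_iff)
    then have "pos x \<noteq> pos a" "pos x \<noteq> pos b"
      using inj that(3) by (auto dest: inj_onD)
    then show ?thesis
      using pos_in_trace [OF that(1) \<open>a \<noteq> b\<close> that(2)] by simp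
  qed
  note xs = this [OF p1 x1] this [OF p2 x2] this [OF p3 x3]
  have i: "path_image c1 \<inter> path_image c2 \<subseteq> {pos a, pos b}"
      "path_image c1 \<inter> path_image c3 \<subseteq> {pos a, pos b}"
      "path_image c2 \<inter> path_image c3 \<subseteq> {pos a, pos b}"
    using trace_meet_ends [OF p1 x1 p2 p12] trace_meet_ends [OF p1 x1 p3 p13]
      trace_meet_ends [OF p2 x2 p3 p23] c1 c2 c3 by simp_all
  show False
    by (rule theta_tripod [OF c1(1-3) c2(1-3) c3(1-3) i conX disj])
      (use clX xs c1 c2 c3 in blast)+
qed

end

section \<open>Paths in trees\<close>

lemma path_edges_append:
  "path_edges (p @ y # q) = path_edges (p @ [y]) \<union> path_edges (y # q)"
  by (induction p rule: path_edges.induct) auto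

lemma path_edges_rev: "path_edges (rev p) = path_edges p"
proof (induction p rule: path_edges.induct)
  case (1 x y p)
  then show ?case
    using path_edges_append [of "rev p" y "[x]"] by (auto simp: insert_commute)
qed auto

lemma is_path_rev: "is_path E x p y \<Longrightarrow> is_path E y (rev p) x"
  by (auto simp: is_path_iff path_edges_rev hd_rev last_rev)

lemma is_path_append_iff:
  "is_path E x (p @ y # q) z \<longleftrightarrow>
     is_path E x (p @ [y]) y \<and> is_path E y (y # q) z \<and> set p \<inter> set q = {}"
  unfolding is_path_iff path_edges_append [of p y q] by (cases p) auto

lemma is_cycle_Cons:
  assumes "distinct (x # p)" "length p \<ge> 2" "path_edges (x # p) \<subseteq> E" "{last p, x} \<in> E"
  shows "is_cycle E (x # p)"
proof -
  have "{(x # p) ! j, (x # p) ! (Suc j mod length (x # p))} \<in> E" if "j < length (x # p)" for j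
  proof (cases "Suc j < length (x # p)")
    case True
    then have "{(x # p) ! j, (x # p) ! Suc j} \<in> E"
      using assms(3) unfolding path_edges_subset_iff by (rule successively_nth[rotated])
    then show ?thesis
      using True by simp
  next
    case False
    then have "j = length p"
      using that by simp
    moreover have "(x # p) ! length p = last p"
      using assms(2) by (cases p rule: rev_cases) (auto simp: nth_append)
    ultimately show ?thesis
      using assms(4) by simp
  qed
  then show ?thesis
    using assms(1,2) by (auto simp: is_cycle_def cycle_edges_def)
qed

text \<open>If two paths part after \<open>x\<close>, the first vertex at which one of them returns
  to the other closes a cycle.\<close>

lemma path_unique:
  assumes "\<nexists>cs. is_cycle E cs" "is_path E x p y" "is_path E x q y"
  shows "p = q"
  using assms(2,3)
proof (induction p arbitrary: x q)
  case Nil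
  then show ?case by (simp add: is_path_iff)
next
  case (Cons x' p)
  have [simp]: "x' = x"
    using Cons.prems by (simp add: is_path_iff)
  obtain q' where q: "q = x # q'"
    using Cons.prems(2) by (cases q) (auto simp: is_path_iff)
  note paths = Cons.prems [unfolded q]
  show ?case
  proof (cases "p = [] \<or> q' = []")
    case True
    then have "p = [] \<and> q' = []"
      using paths last_in_set [of p] last_in_set [of q'] by (auto simp: is_path_iff split: if_splits)
    then show ?thesis
      by (simp add: q)
  next
    case False
    then obtain u p1 v q1 where uv: "p = u # p1" "q' = v # q1"
      by (meson list.exhaust)
    show ?thesis
    proof (cases "u = v")
      case True
      then have "is_path E u p y" "is_path E u q' y"
        using paths uv by (auto simp: is_path_iff)
      then show ?thesis
        using Cons.IH q by simp
    next
      case False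
      have "y \<in> set p" "y \<in> set q'"
        using paths uv last_in_set [of p] last_in_set [of q'] by (auto simp: is_path_iff)
      then have "\<exists>z\<in>set p. z \<in> set q'"
        by blast
      then obtain pa z pb where z: "p = pa @ z # pb" "z \<in> set q'" "\<forall>w\<in>set pa. w \<notin> set q'"
        by (rule split_list_first_propE)
      obtain qa qb where qa: "q' = qa @ z # qb"
        using z(2) by (meson split_list)
      have P: "is_path E x ((x # pa) @ [z]) z" "is_path E x ((x # qa) @ [z]) z"
        using paths is_path_append_iff [of E x "x # pa" z pb y]
          is_path_append_iff [of E x "x # qa" z qb y] z(1) qa by auto
      \<comment> \<open>Along \<open>p\<close> up to the meeting vertex \<open>z\<close>, then back
        along \<open>q\<close>. Since \<open>u \<noteq> v\<close>, \<open>pa\<close> and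
        \<open>qa\<close> are not both empty, so there are at least three vertices.\<close>
      let ?c = "x # (pa @ z # rev qa)"
      have "path_edges ?c = path_edges ((x # pa) @ [z]) \<union> path_edges (rev (qa @ [z]))"
        using path_edges_append [of "x # pa" z "rev qa"] by simp
      also have "path_edges (rev (qa @ [z])) \<subseteq> path_edges ((x # qa) @ [z])"
        unfolding path_edges_rev by (cases "qa @ [z]") auto
      finally have "path_edges ?c \<subseteq> E"
        using P by (auto simp: is_path_iff)
      moreover have "distinct ?c"
        using paths z qa by (auto simp: is_path_iff)
      moreover have "{last (pa @ z # rev qa), x} \<in> E"
        using P(2) by (cases qa) (auto simp: is_path_iff insert_commute last_rev)
      moreover have "length (pa @ z # rev qa) \<ge> 2"
        using False uv z(1) qa by (cases pa; cases qa) auto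
      ultimately have "is_cycle E ?c"
        by (intro is_cycle_Cons)
      then show ?thesis
        using assms(1) by blast
    qed
  qed
qed

section \<open>Betweenness, medians and heights in a tree\<close>

locale tree_graph =
  fixes V :: "'a set" and E :: "'a set set"
  assumes tree: "tree V E"
begin

abbreviation P :: "'a \<Rightarrow> 'a \<Rightarrow> 'a set" where
  "P x y \<equiv> set (tpath E x y)"

lemma finite_V: "finite V" and edge: "e \<in> E \<Longrightarrow> e \<subseteq> V \<and> card e = 2"
  using tree by (auto simp: tree_def simple_graph_def)

lemma finite_E: "finite E"
  using finite_V edge by (meson PowI finite_Pow_iff finite_subset subsetI)

lemma tpath_eq: "is_path E x p y \<Longrightarrow> tpath E x y = p"
  unfolding tpath_def using path_unique tree by (metis (mono_tags, lifting) the_equality tree_def)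

lemma tpath: "\<lbrakk>x \<in> V; y \<in> V\<rbrakk> \<Longrightarrow> is_path E x (tpath E x y) y"
  using tree tpath_eq unfolding tree_def by metis

lemma P_subset: "\<lbrakk>x \<in> V; y \<in> V\<rbrakk> \<Longrightarrow> P x y \<subseteq> V"
  using tree tpath_eq unfolding tree_def by metis

lemma P_ends: "\<lbrakk>x \<in> V; y \<in> V\<rbrakk> \<Longrightarrow> x \<in> P x y \<and> y \<in> P x y"
  using tpath [of x y] by (metis hd_in_set is_path_def last_in_set)

lemma P_sym: "\<lbrakk>x \<in> V; y \<in> V\<rbrakk> \<Longrightarrow> P x y = P y x"
  using tpath_eq [OF is_path_rev [OF tpath]] by (metis set_rev)

lemma P_refl: "P x x = {x}"
  using tpath_eq [of x "[x]" x] by (simp add: is_path_iff)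

lemma P_split:
  assumes "x \<in> V" "z \<in> V" "y \<in> P x z"
  shows "P x z = P x y \<union> P y z" "P x y \<inter> P y z = {y}"
proof -
  obtain p q where pq: "tpath E x z = p @ y # q"
    using split_list [OF assms(3)] by blast
  then have "is_path E x (p @ y # q) z"
    using tpath [OF assms(1,2)] by simp
  then have "is_path E x (p @ [y]) y" "is_path E y (y # q) z" "set p \<inter> set q = {}" "y \<notin> set p" "y \<notin> set q"
    by (simp_all add: is_path_append_iff [of E x p y q z]) (simp_all add: is_path_iff)
  then show "P x z = P x y \<union> P y z" "P x y \<inter> P y z = {y}"
    using pq by (auto dest!: tpath_eq)
qed

text \<open>A converse of the second part of \<open>P_split\<close>; together they let vertex sets
  replace lists in the arguments about betweenness.\<close>

lemma P_join:
  assumes "x \<in> V" "y \<in> V" "z \<in> V" "P x y \<inter> P y z \<subseteq> {y}"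
  shows "y \<in> P x z"
proof -
  obtain p where p: "tpath E x y = p @ [y]"
    using tpath [OF assms(1,2)] by (metis append_butlast_last_id is_path_def)
  obtain q where q: "tpath E y z = y # q"
    using tpath [OF assms(2,3)] by (metis is_path_def list.collapse)
  have "distinct (p @ [y])" "distinct (y # q)"
    using tpath assms p q by (metis is_path_def)+
  then have "is_path E x (p @ y # q) z"
    using tpath [OF assms(1,2)] tpath [OF assms(2,3)] p q assms(4)
      is_path_append_iff [of E x p y q z] by auto
  from tpath_eq [OF this] show ?thesis
    by simp
qed

lemma card_le_degree:
  assumes "\<And>n. n \<in> N \<Longrightarrow> {v, n} \<in> E"
  shows "card N \<le> degree E v"
proof -
  have "inj_on (\<lambda>n. {v, n}) N"
    by (auto simp: inj_on_def doubleton_eq_iff)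
  moreover have "(\<lambda>n. {v, n}) ` N \<subseteq> {e \<in> E. v \<in> e}"
    using assms by auto
  ultimately show ?thesis
    unfolding degree_def using finite_E by (intro card_inj_on_le) auto
qed

lemma degree_eq_card: "degree E v = card {n. {v, n} \<in> E}"
proof -
  have "bij_betw (\<lambda>n. {v, n}) {n. {v, n} \<in> E} {e \<in> E. v \<in> e}"
  proof (rule bij_betw_imageI)
    show "inj_on (\<lambda>n. {v, n}) {n. {v, n} \<in> E}"
      by (auto simp: inj_on_def doubleton_eq_iff)
    show "(\<lambda>n. {v, n}) ` {n. {v, n} \<in> E} = {e \<in> E. v \<in> e}"
    proof (intro equalityI subsetI)
      fix e assume e: "e \<in> {e \<in> E. v \<in> e}"
      then obtain a b where "e = {a, b}"
        using edge [of e] by (auto simp: card_2_iff)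
      then show "e \<in> (\<lambda>n. {v, n}) ` {n. {v, n} \<in> E}"
        using e by (auto simp: insert_commute)
    qed auto
  qed
  then show ?thesis
    unfolding degree_def by (simp add: bij_betw_same_card)
qed

lemma append_edge:
  "is_path E x (p @ [u, v] @ q) z \<Longrightarrow> {u, v} \<in> E"
  using is_path_append_iff [of E x p u "v # q"] by (auto simp: is_path_iff)

text \<open>\<open>m\<close> is the first vertex of the path from \<open>x\<close> to
  \<open>y\<close> that lies on \<open>P y z\<close>. If it is none of the three ends, it has a
  neighbour towards each of them, and these differ.\<close>

lemma median:
  assumes "x \<in> V" "y \<in> V" "z \<in> V"
  obtains m where "m \<in> P x y" "m \<in> P y z" "m \<in> P x z" "m \<notin> {x, y, z} \<Longrightarrow> degree E m \<ge> 3"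
proof -
  have "\<exists>w\<in>P x y. w \<in> P y z"
    using P_ends assms by blast
  then obtain p1 m p2 where p: "tpath E x y = p1 @ m # p2" "m \<in> P y z" "\<forall>w\<in>set p1. w \<notin> P y z"
    by (rule split_list_first_propE)
  obtain q1 q2 where q: "tpath E y z = q1 @ m # q2"
    using p(2) by (meson split_list)
  have P: "is_path E x (p1 @ m # p2) y" "is_path E y (q1 @ m # q2) z"
    using tpath [OF assms(1,2)] tpath [OF assms(2,3)] p(1) q by simp_all
  have "is_path E x (p1 @ m # q2) z"
    using P p(3) q is_path_append_iff [of E x p1 m q2 z] is_path_append_iff [of E x p1 m p2 y]
      is_path_append_iff [of E y q1 m q2 z] by auto
  then have xz: "tpath E x z = p1 @ m # q2"
    by (rule tpath_eq)
  have "degree E m \<ge> 3" if m: "m \<notin> {x, y, z}"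
  proof -
    have "p1 \<noteq> []" "q1 \<noteq> []" "q2 \<noteq> []"
      using P m by (auto simp: is_path_iff)
    then obtain p1' a q1' b c q2' where abc: "p1 = p1' @ [a]" "q1 = q1' @ [b]" "q2 = c # q2'"
      by (meson neq_Nil_conv rev_exhaust)
    have "{a, m} \<in> E" "{b, m} \<in> E" "{m, c} \<in> E"
      using P abc append_edge [of x p1' a m p2 y] append_edge [of y q1' b m q2 z]
        append_edge [of y q1 m c q2' z] by auto
    then have "card {a, b, c} \<le> degree E m"
      by (intro card_le_degree) (auto simp: insert_commute)
    moreover have "a \<noteq> b" "b \<noteq> c" "a \<noteq> c"
      using p(3) q abc P(2) by (auto simp: is_path_iff)
    ultimately show ?thesis
      by simp
  qed
  then show ?thesis
    using that [of m] p q xz by auto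
qed

lemma P_triangle:
  assumes "x \<in> V" "y \<in> V" "z \<in> V"
  shows "P x z \<subseteq> P x y \<union> P y z"
proof -
  obtain m where m: "m \<in> P x y" "m \<in> P y z" "m \<in> P x z"
    using median [OF assms] by metis
  show ?thesis
    using P_split(1) [OF assms(1,3) m(3)] P_split(1) [OF assms(1,2) m(1)]
      P_split(1) [OF assms(2,3) m(2)] by blast
qed

lemma P_antisym:
  assumes "s \<in> V" "u \<in> V" "v \<in> V" "u \<in> P s v" "v \<in> P s u"
  shows "u = v"
proof -
  have "v \<in> P s u \<inter> P u v"
    using P_ends [OF assms(2,3)] assms(5) by simp
  then show ?thesis
    unfolding P_split(2) [OF assms(1,3,4)] by simp
qed

lemma leaf_in_P:
  assumes "l \<in> leaves V E" "x \<in> V" "y \<in> V" "l \<in> P x y"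
  shows "l = x \<or> l = y"
proof (rule ccontr)
  assume l: "\<not> (l = x \<or> l = y)"
  obtain p q where "tpath E x y = p @ l # q"
    using assms(4) by (meson split_list)
  then have P: "is_path E x (p @ l # q) y"
    using tpath [OF assms(2,3)] by simp
  then have "p \<noteq> []" "q \<noteq> []"
    using l by (auto simp: is_path_iff)
  then obtain p' a b q' where ab: "p = p' @ [a]" "q = b # q'"
    by (meson neq_Nil_conv rev_exhaust)
  then have "{a, l} \<in> E" "{l, b} \<in> E" "a \<noteq> b"
    using P append_edge [of x p' a l q y] append_edge [of x p l b q' y] by (auto simp: is_path_iff)
  then have "card {a, b} \<le> degree E l"
    by (intro card_le_degree) (auto simp: insert_commute)
  then show False
    using assms(1) \<open>a \<noteq> b\<close> by (simp add: leaves_def)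
qed

lemma P_edge:
  assumes "{u, v} \<in> E"
  shows "tpath E u v = [u, v]" "u \<in> V" "v \<in> V" "u \<noteq> v"
proof -
  show uv: "u \<noteq> v" "u \<in> V" "v \<in> V"
    using edge [OF assms] by auto
  then show "tpath E u v = [u, v]"
    using assms by (intro tpath_eq) (simp add: is_path_iff)
qed

lemma card_P: "\<lbrakk>x \<in> V; y \<in> V\<rbrakk> \<Longrightarrow> card (P x y) = Suc (height E x y)"
  using tpath [of x y] by (cases "tpath E x y") (auto simp: is_path_iff height_def distinct_card)

lemma height_split:
  assumes "x \<in> V" "z \<in> V" "y \<in> P x z"
  shows "height E x z = height E x y + height E y z"
proof -
  have y: "y \<in> V"
    using assms P_subset by blast
  have "card (P x z) + card {y} = card (P x y) + card (P y z)"
    using card_Un_Int [of "P x y" "P y z"] P_split [OF assms] by simp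
  then show ?thesis
    using card_P assms y by simp
qed

lemma height_pos: "\<lbrakk>x \<in> V; y \<in> V; x \<noteq> y\<rbrakk> \<Longrightarrow> height E x y > 0"
  using card_P [of x y] P_ends [of x y] card_mono [of "P x y" "{x, y}"] by simp

lemma height_Suc_edge:
  assumes "s \<in> V" "v \<in> V" "u \<in> P s v" "height E s v = Suc (height E s u)"
  shows "{u, v} \<in> E"
proof -
  have u: "u \<in> V"
    using assms P_subset by blast
  have "height E u v = 1"
    using height_split [OF assms(1-3)] assms(4) by simp
  then have "length (tpath E u v) = 2"
    unfolding height_def by simp
  then obtain a b where "tpath E u v = [a, b]"
    by (auto simp: numeral_2_eq_2 length_Suc_conv)
  then show ?thesis
    using tpath [OF u assms(2)] by (auto simp: is_path_iff)
qed

text \<open>The median of \<open>s\<close>, \<open>u\<close>, \<open>v\<close> lies on the edge,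
  hence is \<open>u\<close> or \<open>v\<close>.\<close>

lemma edge_ancestor:
  assumes "s \<in> V" "{u, v} \<in> E"
  shows "u \<in> P s v \<and> height E s v = Suc (height E s u) \<or>
         v \<in> P s u \<and> height E s u = Suc (height E s v)"
proof -
  have uv: "u \<in> V" "v \<in> V" "height E u v = 1" "height E v u = 1" "P u v = {u, v}"
    using P_edge [of u v] P_edge [of v u] assms(2) by (auto simp: height_def insert_commute)
  obtain m where "m \<in> P s u" "m \<in> P u v" "m \<in> P s v"
    using median [OF assms(1) uv(1,2)] by metis
  then have "u \<in> P s v \<or> v \<in> P s u"
    using uv by auto
  then show ?thesis
    using height_split [OF assms(1)] uv by fastforce
qed

lemma ancestors_linear:
  assumes "s \<in> V" "y \<in> V" "u \<in> P s y" "v \<in> P s y"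
  shows "u \<in> P s v \<or> v \<in> P s u"
proof -
  have uv: "u \<in> V" "v \<in> V"
    using assms P_subset by blast+
  have "v \<in> P s u \<or> v \<in> P u y"
    using P_split [OF assms(1-3)] assms(4) by blast
  then show ?thesis
  proof
    assume v: "v \<in> P u y"
    have "P s u \<inter> P u v \<subseteq> {u}"
      using P_split [OF assms(1-3)] P_split(1) [OF uv(1) assms(2) v] by blast
    then show ?thesis
      using P_join assms(1) uv by blast
  qed auto
qed

text \<open>A deepest vertex \<open>y\<close> below \<open>v\<close> has no child, so every
  neighbour is a parent; since the ancestors of \<open>y\<close> form a chain, there is only
  one.\<close>

lemma descendant_leaf:
  assumes "s \<in> V" "v \<in> V" "V \<noteq> {s}"
  obtains w where "w \<in> leaves V E" "v \<in> P s w"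
proof -
  let ?D = "{y \<in> V. v \<in> P s y}"
  have "Max (height E s ` ?D) \<in> height E s ` ?D"
    using finite_V P_ends assms by (intro Max_in) auto
  then obtain y where y: "y \<in> ?D" "height E s y = Max (height E s ` ?D)"
    by force
  have y_max: "height E s z \<le> height E s y" if "z \<in> ?D" for z
    unfolding y(2) using finite_V that by (intro Max_ge) auto
  have up: "n \<in> P s y \<and> height E s y = Suc (height E s n)" if "{y, n} \<in> E" for n
  proof (rule ccontr)
    assume "\<not> ?thesis"
    then have n: "y \<in> P s n" "height E s n = Suc (height E s y)"
      using edge_ancestor [OF assms(1) that] by blast+
    have "n \<in> V"
      using P_edge that by blast
    then have "n \<in> ?D"
      using P_split(1) [OF assms(1) _ n(1)] y(1) by blast
    then show False
      using y_max n(2) by fastforce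
  qed
  have "y \<noteq> s"
  proof
    assume "y = s"
    obtain z where z: "z \<in> V" "z \<noteq> s"
      using assms by blast
    have "height E s s = 0"
      using card_P [OF assms(1,1)] P_refl by simp
    moreover have "v = s"
      using y(1) \<open>y = s\<close> P_refl by auto
    ultimately show False
      using y_max [of z] z height_pos [OF assms(1) z(1)] P_ends assms(1) \<open>y = s\<close> by force
  qed
  have "{n. {y, n} \<in> E} \<noteq> {}"
  proof -
    have P: "is_path E y (tpath E y s) s"
      using tpath assms(1) y(1) by blast
    then obtain p where p: "tpath E y s = y # p"
      by (metis is_path_def list.collapse)
    then have "p \<noteq> []"
      using P \<open>y \<noteq> s\<close> by (auto simp: is_path_iff)
    then show ?thesis
      using P p by (cases p) (auto simp: is_path_iff)
  qed
  moreover have "n = n'" if "{y, n} \<in> E" "{y, n'} \<in> E" for n n'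
  proof -
    have nV: "n \<in> V" "n' \<in> V"
      using P_edge that by blast+
    have "n \<in> P s n' \<or> n' \<in> P s n"
      using ancestors_linear [OF assms(1)] y(1) up that by blast
    then show ?thesis
      using height_split [OF assms(1) nV(1), of n'] height_split [OF assms(1) nV(2), of n]
        up [OF that(1)] up [OF that(2)] height_pos [OF nV] height_pos [OF nV(2,1)]
      by (metis add_cancel_left_right nat.inject not_gr_zero)
  qed
  ultimately obtain n where "{n. {y, n} \<in> E} = {n}"
    by blast
  then have "degree E y = 1"
    by (simp add: degree_eq_card)
  then show ?thesis
    using that [of y] y(1) by (simp add: leaves_def)
qed

end

section \<open>The leaves below a vertex\<close>

lemma planar_drawing:
  assumes "simple_graph V E" "planar V E"
  obtains pos \<gamma> where "plane_drawing V E pos \<gamma>"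
proof -
  obtain pos :: "'a \<Rightarrow> complex" and \<gamma> where "inj_on pos V \<and>
      (\<forall>e\<in>E. arc (\<gamma> e) \<and> {pathstart (\<gamma> e), pathfinish (\<gamma> e)} = pos ` e \<and>
        path_image (\<gamma> e) \<inter> pos ` V = pos ` e) \<and>
      (\<forall>e\<in>E. \<forall>f\<in>E. e \<noteq> f \<longrightarrow> path_image (\<gamma> e) \<inter> path_image (\<gamma> f) \<subseteq> pos ` (e \<inter> f))"
    using assms(2) unfolding planar_def by (elim exE)
  note d = this [THEN conjunct1] this [THEN conjunct2, THEN conjunct1, THEN bspec]
    this [THEN conjunct2, THEN conjunct2, THEN bspec, THEN bspec, THEN mp]
  have "plane_drawing V E pos \<gamma>"
  proof
    show "simple_graph V E" "inj_on pos V"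
      using assms(1) d(1) by auto
    show "arc (\<gamma> e)" "{pathstart (\<gamma> e), pathfinish (\<gamma> e)} = pos ` e" if "e \<in> E" for e
      using d(2) [OF that] by auto
  qed (rule d(3))
  then show ?thesis
    by (rule that)
qed

lemma is_path_mono: "is_path E x p y \<Longrightarrow> E \<subseteq> E' \<Longrightarrow> is_path E' x p y"
  by (auto simp: is_path_iff)

section \<open>The relabelled cycle and the new root\<close>

locale rooted_tuc =
  fixes V :: "'a set" and E ET :: "'a set set" and cs :: "'a list" and r :: 'a and i :: nat
  assumes tuc: "tree_union_cycle V E ET cs"
    and r: "r \<in> V - set cs"
    and good: "good_pair ET cs i"
    and admissible: "root_admissible ET cs r i"
begin

sublocale tree_graph V ET
  using tuc by unfold_locales (simp add: tree_union_cycle_def)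

abbreviation k :: nat where "k \<equiv> length cs"

text \<open>Indices are not bounded by \<open>k\<close>: \<open>b\<close> is periodic, so the
  closing edge is the instance \<open>j = k - 1\<close> of \<open>b_edge\<close>.\<close>

definition b :: "nat \<Rightarrow> 'a" where "b j = cyc cs (i + j)"

definition s :: 'a where "s = new_root ET cs r i"

definition below :: "'a \<Rightarrow> 'a set" where "below v = leaves_below V ET s v"

lemma graph: "simple_graph V E" "planar V E" "E = ET \<union> cycle_edges cs" "set cs = leaves V ET"
    "{e \<in> E. e \<subseteq> leaves V ET} = cycle_edges cs"
  and k: "k \<ge> 3" and distinct_cs: "distinct cs"
  using tuc unfolding tree_union_cycle_def is_cycle_def by blast+

lemma b_inj: "\<lbrakk>b p = b q; p < k; q < k\<rbrakk> \<Longrightarrow> p = q"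
proof -
  assume bq: "b p = b q" and pq: "p < k" "q < k"
  have "k > 0"
    using k by linarith
  then have "(i + p) mod k = (i + q) mod k"
    using bq distinct_cs unfolding b_def cyc_def by (simp add: nth_eq_iff_index_eq)
  \<comment> \<open>Subtraction of naturals truncates at 0, so both differences are needed.\<close>
  then have "k dvd (i + q) - (i + p)" "k dvd (i + p) - (i + q)"
    by (metis dvd_0_right diff_is_0_eq mod_eq_dvd_iff_nat nle_le)+
  then have "k dvd q - p" "k dvd p - q"
    by simp_all
  then have "q - p = 0" "p - q = 0"
    using pq by (metis dvd_imp_le less_imp_diff_less not_gr_zero not_le)+
  then show "p = q"
    by simp
qed

lemma inj_b: "inj_on b {..<k}"
  using b_inj by (auto simp: inj_on_def)

lemma b_mod: "b (j mod k) = b j"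
  unfolding b_def cyc_def by (simp add: mod_add_right_eq)

lemma leaves_b: "leaves V ET = b ` {..<k}"
proof
  have "k > 0"
    using k by linarith
  then have "b ` {..<k} \<subseteq> set cs"
    unfolding b_def cyc_def by auto
  moreover have "card (b ` {..<k}) = card (set cs)"
    using distinct_cs inj_b by (simp add: card_image distinct_card)
  ultimately have "b ` {..<k} = set cs"
    by (simp add: card_subset_eq)
  then show "leaves V ET \<subseteq> b ` {..<k}" "b ` {..<k} \<subseteq> leaves V ET"
    using graph(4) by simp_all
qed

lemma b_leaf: "j < k \<Longrightarrow> b j \<in> leaves V ET"
  using leaves_b by blast

lemma leaf_V: "l \<in> leaves V ET \<Longrightarrow> l \<in> V"
  by (simp add: leaves_def)

lemma b_edge: "{b j, b (Suc j)} \<in> cycle_edges cs"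
proof -
  let ?t = "(i + j) mod k"
  have "?t < k"
    using k by (intro mod_less_divisor) linarith
  moreover have "b j = cs ! ?t" "b (Suc j) = cs ! (Suc ?t mod k)"
    by (simp_all add: b_def cyc_def mod_Suc_eq)
  ultimately show ?thesis
    unfolding cycle_edges_def mem_Collect_eq by (intro exI [of _ ?t]) simp
qed

lemma b_edge_iff:
  assumes "p < q" "q < k"
  shows "{b p, b q} \<in> cycle_edges cs \<longleftrightarrow> q = Suc p \<or> p = 0 \<and> q = k - 1"
proof
  assume "{b p, b q} \<in> cycle_edges cs"
  then obtain t where t: "t < k" "{b p, b q} = {cs ! t, cs ! (Suc t mod k)}"
    unfolding cycle_edges_def by blast
  have "cs ! t \<in> b ` {..<k}"
    using t(1) graph(4) leaves_b by (metis nth_mem)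
  then obtain j where j: "j < k" "cs ! t = b j"
    by auto
  then have "(i + j) mod k = t"
    using t(1) distinct_cs unfolding b_def cyc_def
    by (metis mod_less_divisor nth_eq_iff_index_eq length_greater_0_conv list.size(3) not_less_zero)
  then have "cs ! (Suc t mod k) = b (Suc j mod k)"
    unfolding b_mod by (auto simp: b_def cyc_def mod_Suc_eq)
  then have "{b p, b q} = {b j, b (Suc j mod k)}"
    using t(2) j(2) by simp
  moreover have "Suc j mod k < k"
    using k by (intro mod_less_divisor) linarith
  ultimately have "p = j \<and> q = Suc j mod k \<or> q = j \<and> p = Suc j mod k"
    using b_inj assms j(1) unfolding doubleton_eq_iff by (metis dual_order.strict_trans)
  then show "q = Suc p \<or> p = 0 \<and> q = k - 1"
    using assms j(1) by (cases "Suc j = k") auto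
next
  assume "q = Suc p \<or> p = 0 \<and> q = k - 1"
  then show "{b p, b q} \<in> cycle_edges cs"
  proof
    assume "p = 0 \<and> q = k - 1"
    moreover have "b k = b 0" "Suc (k - 1) = k"
      using b_mod [of k] k by (simp, linarith)
    ultimately show ?thesis
      using b_edge [of "k - 1"] by (simp only: insert_commute)
  qed (use b_edge in simp)
qed

text \<open>The neighbour of \<open>l\<close> on the way to \<open>y\<close> is closer to
  \<open>r\<close>, since otherwise the leaf \<open>l\<close> would be an inner vertex of a path
  from \<open>r\<close>. Hence a vertex of least height between \<open>b 0\<close> and
  \<open>b 1\<close> is not one of these two leaves.\<close>

lemma climb:
  assumes "l \<in> leaves V ET" "y \<in> V" "y \<noteq> l"
  obtains z where "z \<in> P l y" "height ET r z < height ET r l"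
proof -
  have lV: "l \<in> V"
    using assms leaf_V by simp
  have path: "is_path ET l (tpath ET l y) y"
    using tpath [OF lV assms(2)] .
  then obtain p where p: "tpath ET l y = l # p"
    by (metis is_path_def list.collapse)
  obtain z p' where z: "p = z # p'"
    using path p assms(3) by (cases p) (auto simp: is_path_iff)
  have e: "{l, z} \<in> ET"
    using path p z by (auto simp: is_path_iff)
  have "l \<notin> P r z"
    using leaf_in_P [OF assms(1), of r z] P_edge [OF e] r graph(4) assms(1) by auto
  then have "height ET r z < height ET r l"
    using edge_ancestor [OF _ e, of r] r by auto
  then show ?thesis
    using that [of z] p z by simp
qed

lemma b01: "b 0 \<in> V" "b 1 \<in> V" "b 0 \<noteq> b 1" "b 0 \<in> leaves V ET" "b 1 \<in> leaves V ET"
proof -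
  have "0 < k" "1 < k"
    using k by linarith+
  then show b: "b 0 \<in> leaves V ET" "b 1 \<in> leaves V ET" "b 0 \<noteq> b 1"
    using b_leaf [of 0] b_leaf [of 1] b_inj [of 0 1] by auto
  show "b 0 \<in> V" "b 1 \<in> V"
    using b(1,2) [THEN leaf_V] .
qed

lemma s: "s \<in> P (b 0) (b 1)" "s \<in> V" "s \<notin> leaves V ET"
proof -
  have s: "s = arg_min_on (height ET r) (P (b 0) (b 1))"
    by (simp add: s_def new_root_def hca_def b_def)
  have fin: "finite (P (b 0) (b 1))" "P (b 0) (b 1) \<noteq> {}"
    using P_ends [OF b01(1,2)] by auto
  show sP: "s \<in> P (b 0) (b 1)"
    unfolding s using arg_min_if_finite(1) [OF fin] .
  then show "s \<in> V"
    using P_subset b01 by blast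
  have least: "\<not> height ET r z < height ET r s" if "z \<in> P (b 0) (b 1)" for z
    using arg_min_if_finite(2) [OF fin, of "height ET r"] that unfolding s by blast
  have "s \<noteq> b 0"
    using climb [OF b01(4,2)] b01(3) least by metis
  moreover have "s \<noteq> b 1"
    using climb [OF b01(5,1)] b01(3) least P_sym [OF b01(1,2)] by metis
  ultimately show "s \<notin> leaves V ET"
    using leaf_in_P [OF _ b01(1,2) sP] by blast
qed

section \<open>Subtrees that contain \<open>b 0\<close> or \<open>b 1\<close>\<close>

lemma below_iff: "l \<in> below v \<longleftrightarrow> l \<in> leaves V ET \<and> v \<in> P s l"
  by (simp add: below_def leaves_below_def ancestor_def)

text \<open>The median of \<open>b 0\<close>, \<open>b 1\<close> and any third leaf has degree at
  least 3, so it is the one vertex that \<open>good_pair\<close> exempts.\<close>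

lemma branch_vertex:
  obtains x where "x \<in> V" "x \<in> P s (b 0)" "s \<in> P x (b 1)"
    "\<And>l. l \<in> leaves V ET \<Longrightarrow> l \<noteq> b 0 \<Longrightarrow> l \<noteq> b 1 \<Longrightarrow> x \<in> P (b 1) l \<and> x \<in> P (b 0) l"
proof -
  obtain x where x: "x \<in> P (b 0) (b 1) - {b 0, b 1}"
      "\<And>w. w \<in> P (b 0) (b 1) - {b 0, b 1} \<Longrightarrow> w \<noteq> x \<Longrightarrow> degree ET w = 2"
    using good unfolding good_pair_def inner_vertices_def by (auto simp: b_def)
  have med: "x \<in> P (b 1) l \<and> x \<in> P (b 0) l \<and> degree ET x \<ge> 3"
    if l: "l \<in> leaves V ET" "l \<noteq> b 0" "l \<noteq> b 1" for l
  proof -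
    have lV: "l \<in> V"
      using l leaf_V by simp
    obtain m where m: "m \<in> P (b 0) (b 1)" "m \<in> P (b 1) l" "m \<in> P (b 0) l"
        "m \<notin> {b 0, b 1, l} \<Longrightarrow> degree ET m \<ge> 3"
      using median [OF b01(1,2) lV] by metis
    have "m \<noteq> b 0" "m \<noteq> b 1" "m \<noteq> l"
      using leaf_in_P [OF b01(4) b01(2) lV] leaf_in_P [OF b01(5) b01(1) lV]
        leaf_in_P [OF l(1) b01(1,2)] m l b01(3) by auto
    then have "degree ET m \<ge> 3" "m \<in> P (b 0) (b 1) - {b 0, b 1}"
      using m by auto
    moreover then have "m = x"
      using x(2) [of m] by fastforce
    ultimately show ?thesis
      using m by simp
  qed
  have xV: "x \<in> V"
    using x(1) P_subset [OF b01(1,2)] by blast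
  \<comment> \<open>As \<open>k \<ge> 3\<close>, the third leaf \<open>b 2\<close> exists.
    Admissibility then keeps \<open>x\<close> from lying strictly between \<open>s\<close> and
    \<open>b 1\<close>.\<close>
  have "degree ET x \<noteq> 2"
    using med [of "b 2"] b_leaf [of 2] b_inj [of 2 0] b_inj [of 2 1] k by force
  moreover have "degree ET w = 2" if "w \<in> P s (b 1) - {s, b 1}" for w
    using admissible that unfolding root_admissible_def inner_vertices_def by (simp add: s_def b_def)
  ultimately have "x \<notin> P s (b 1) \<or> x = s"
    using x(1) by blast
  then have xs: "x \<in> P (b 0) s"
    using P_split(1) [OF b01(1,2) s(1)] x(1) P_ends [OF b01(1) s(2)] by blast
  have "s \<in> P (b 0) x \<or> s \<in> P x (b 1)"
    using P_split(1) [OF b01(1,2), of x] x(1) s(1) by blast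
  then have "s \<in> P x (b 1)"
    using P_antisym [OF b01(1) s(2) xV _ xs] P_ends [OF xV b01(2)] by blast
  moreover have "x \<in> P s (b 0)"
    using xs P_sym [OF b01(1) s(2)] by simp
  ultimately show ?thesis
    using that [OF xV] med by blast
qed

text \<open>The path from \<open>b 1\<close> to a third leaf passes through \<open>x\<close>, and on
  the way it passes \<open>s\<close>.\<close>

lemma s_between_b1:
  assumes "l \<in> leaves V ET" "l \<noteq> b 1"
  shows "s \<in> P l (b 1)"
proof (cases "l = b 0")
  case True
  then show ?thesis using s by simp
next
  case False
  obtain x where x: "x \<in> V" "s \<in> P x (b 1)" "x \<in> P (b 1) l"
    using branch_vertex assms False by metis
  have "P (b 1) l = P l (b 1)"
    using P_sym b01 leaf_V assms by simp
  then show ?thesis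
    using P_split(1) [of l "b 1" x] x b01(2) leaf_V [OF assms(1)] by auto
qed

text \<open>The paths from \<open>s\<close> to \<open>b 1\<close> and to any other leaf have only
  \<open>s\<close> in common.\<close>

lemma below_b1:
  assumes "b 1 \<in> below v" "v \<noteq> s" "l \<in> below v"
  shows "l = b 1"
proof (rule ccontr)
  assume "l \<noteq> b 1"
  have l: "l \<in> leaves V ET" "l \<in> V" "v \<in> P s l" "v \<in> P s (b 1)"
    using assms leaf_V by (auto simp: below_iff)
  have "s \<in> P l (b 1)"
    using s_between_b1 l(1) \<open>l \<noteq> b 1\<close> by blast
  from P_split(2) [OF l(2) b01(2) this] have "P s l \<inter> P s (b 1) = {s}"
    unfolding P_sym [OF l(2) s(2)] .
  then show False
    using l assms(2) by blast
qed

text \<open>All leaves but \<open>b 1\<close> are reached from \<open>s\<close> through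
  \<open>x\<close>. If one of them is missed, \<open>v\<close> comes strictly after
  \<open>x\<close>; but the paths from \<open>x\<close> to \<open>b 0\<close> and to
  \<open>l\<close> share only \<open>x\<close>.\<close>

lemma below_b0:
  assumes "b 0 \<in> below v" "v \<noteq> s" "l \<in> below v" "l \<noteq> b 0" "m \<in> leaves V ET" "m \<notin> below v"
  shows "m = b 1"
proof (rule ccontr)
  assume m: "m \<noteq> b 1"
  obtain x where x: "x \<in> V" "x \<in> P s (b 0)" "s \<in> P x (b 1)"
    "\<And>l. l \<in> leaves V ET \<Longrightarrow> l \<noteq> b 0 \<Longrightarrow> l \<noteq> b 1 \<Longrightarrow> x \<in> P (b 1) l \<and> x \<in> P (b 0) l"
    using branch_vertex by blast
  have sx: "x \<in> P s y" if y: "y \<in> leaves V ET" "y \<noteq> b 0" "y \<noteq> b 1" for y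
  proof -
    have yV: "y \<in> V"
      using y leaf_V by simp
    have "P s x \<subseteq> P (b 1) x"
      using P_split(1) [OF x(1) b01(2) x(3)] P_sym s(2) x(1) b01(2) by blast
    moreover have "P (b 1) x \<inter> P x y = {x}"
      using P_split(2) [OF b01(2) yV] x(4) [OF y] by blast
    ultimately show ?thesis
      using P_join [OF s(2) x(1) yV] by blast
  qed
  have l: "l \<in> leaves V ET" "l \<in> V" "v \<in> P s l" "v \<in> P s (b 0)" "l \<noteq> b 1"
    using assms leaf_V below_b1 [of v "b 0"] b01(3) by (auto simp: below_iff)
  have vx: "v \<notin> P s x"
    using P_split(1) [OF s(2) _ sx [OF assms(5) _ m]] assms leaf_V by (auto simp: below_iff)
  have "v \<in> P x (b 0)"
    using P_split(1) [OF s(2) b01(1) x(2)] l(4) vx by blast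
  moreover have "v \<in> P x l"
    using P_split(1) [OF s(2) l(2) sx [OF l(1) assms(4) l(5)]] l(3) vx by blast
  moreover have "P (b 0) x \<inter> P x l = {x}"
    using P_split(2) [OF b01(1) l(2)] x(4) [OF l(1) assms(4) l(5)] by blast
  ultimately have "v = x"
    using P_sym [OF b01(1) x(1)] by blast
  then show False
    using vx P_ends [OF s(2) x(1)] by blast
qed

section \<open>Arcs of the cycle and planarity\<close>

lemma b_path:
  assumes "p \<le> q"
  shows "successively (\<lambda>u v. {u, v} \<in> E) (map b [p..<Suc q])"
proof -
  have "{map b [p..<Suc q] ! t, map b [p..<Suc q] ! Suc t} \<in> E"
    if "Suc t < length (map b [p..<Suc q])" for t
    using b_edge [of "p + t"] graph(3) that by (simp del: upt_Suc)
  then show ?thesis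
    unfolding successively_conv_nth by simp
qed

lemma is_path_upt:
  assumes "p \<le> q" "q < k"
  shows "is_path E (b p) (map b [p..<Suc q]) (b q)"
  unfolding is_path_iff path_edges_subset_iff
proof (intro conjI)
  show "successively (\<lambda>x y. {x, y} \<in> E) (map b [p..<Suc q])"
    using b_path assms by simp
  show "distinct (map b [p..<Suc q])"
    unfolding distinct_map using assms
    by (intro conjI distinct_upt inj_on_subset [OF inj_b]) (auto simp del: upt_Suc)
qed (use assms in \<open>simp_all add: hd_map last_map del: upt_Suc\<close>)

text \<open>Down to \<open>b 0\<close>, over the closing edge to \<open>b (k - 1)\<close>, and down
  again to \<open>b q\<close>.\<close>

lemma is_path_around:
  assumes "p < q" "q < k"
  shows "is_path E (b p) (rev (map b [0..<Suc p]) @ rev (map b [q..<k])) (b q)"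
proof -
  have up: "is_path E (b 0) (map b [0..<Suc p]) (b p)"
    using is_path_upt [of 0 p] assms by simp
  have "Suc (k - 1) = k" "q \<le> k - 1" "k - 1 < k"
    using assms by linarith+
  then have down: "is_path E (b q) (map b [q..<k]) (b (k - 1))"
    using is_path_upt [of q "k - 1"] by (simp only:)
  have "{b 0, b (k - 1)} \<in> E"
    using b_edge_iff [of 0 "k - 1"] graph(3) assms by simp
  moreover have "set (map b [0..<Suc p]) \<inter> set (map b [q..<k]) = {}"
  proof -
    have "b x \<noteq> b y" if "x \<le> p" "q \<le> y" "y < k" for x y
      using b_inj [of x y] that assms by linarith
    then show ?thesis
      by (auto simp del: upt_Suc)
  qed
  ultimately show ?thesis
    using is_path_rev [OF up] is_path_rev [OF down]
    unfolding is_path_iff path_edges_subset_iff successively_append_iff distinct_append set_rev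
    by (simp add: insert_commute del: upt_Suc)
qed

text \<open>The two arcs of \<open>C\<close> between \<open>b p\<close> and \<open>b q\<close> and the tree path between them form a theta curve;
  the tree paths from \<open>s\<close> to \<open>b j\<close>, to \<open>b 0\<close> and to that tree path complete it to \<open>K\<^sub>3\<^sub>,\<^sub>3\<close>.\<close>

lemma no_crossing:
  assumes v: "v \<in> V" and pq: "0 < p" "p < j" "j < q" "q < k"
    and L: "b p \<in> below v" "b q \<in> below v" "b 0 \<notin> below v" "b j \<notin> below v"
  shows False
proof -
  obtain pos \<gamma> where D: "plane_drawing V E pos \<gamma>"
    using planar_drawing [OF graph(1,2)] .
  let ?a = "b p" and ?b = "b q"
  let ?p1 = "map b [p..<Suc q]"
  let ?p2 = "rev (map b [0..<Suc p]) @ rev (map b [q..<k])"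
  have leaf: "?a \<in> leaves V ET" "?b \<in> leaves V ET" "b 0 \<in> leaves V ET" "b j \<in> leaves V ET"
    using pq by (auto intro!: b_leaf)
  note inV = this [THEN leaf_V]
  have vs: "v \<in> P s ?a" "v \<in> P s ?b" "v \<notin> P s (b 0)" "v \<notin> P s (b j)"
    using L leaf by (auto simp: below_iff)
  have ne: "?a \<noteq> ?b" "b 0 \<noteq> ?a" "b 0 \<noteq> ?b" "b j \<noteq> ?a" "b j \<noteq> ?b"
    using b_inj pq by (metis less_trans less_irrefl)+
  have path1: "is_path E ?a ?p1 ?b" and path2: "is_path E ?a ?p2 ?b"
    using is_path_upt [of p q] is_path_around [of p q] pq by linarith+
  have path3: "is_path E ?a (tpath ET ?a ?b) ?b"
    using tpath inV graph(3) by (auto intro: is_path_mono)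
  have p1: "set ?p1 \<subseteq> leaves V ET" and p2: "set ?p2 \<subseteq> leaves V ET"
    using pq unfolding leaves_b by auto
  have p12: "set ?p1 \<inter> set ?p2 \<subseteq> {?a, ?b}"
  proof -
    have "set ?p1 = b ` {p..q}" "set ?p2 = b ` ({..p} \<union> {q..<k})"
      using pq by (auto simp del: upt_Suc)
    moreover have "b ` {p..q} \<inter> b ` ({..p} \<union> {q..<k}) = b ` ({p..q} \<inter> ({..p} \<union> {q..<k}))"
      using pq by (intro inj_on_image_Int [OF inj_b, symmetric]) auto
    moreover have "{p..q} \<inter> ({..p} \<union> {q..<k}) \<subseteq> {p, q}"
      by auto
    ultimately show ?thesis
      by auto
  qed
  have p3: "P ?a ?b \<inter> leaves V ET \<subseteq> {?a, ?b}"
    using leaf_in_P inV by blast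
  \<comment> \<open>The path between two descendants of \<open>v\<close> stays below
    \<open>v\<close>. A path from \<open>s\<close> that avoids \<open>v\<close> therefore avoids it,
    which frees the legs to \<open>b 0\<close> and \<open>b j\<close>.\<close>
  have v_above: "v \<in> P s y" if "y \<in> P ?a ?b" for y
  proof -
    have yV: "y \<in> V"
      using that P_subset inV by blast
    have "y \<in> P v ?a \<or> y \<in> P v ?b"
      using that P_triangle [OF inV(1) v inV(2)] P_sym [OF inV(1) v] by blast
    then have "\<exists>z\<in>{?a, ?b}. y \<in> P v z"
      by blast
    then obtain z where z: "z \<in> V" "v \<in> P s z" "y \<in> P v z"
      using vs inV by blast
    then have "P s v \<inter> P v y \<subseteq> {v}"
      using P_split(2) [OF s(2) z(1,2)] P_split(1) [OF v z(1,3)] by blast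
    then show ?thesis
      using P_join s(2) v yV by blast
  qed
  have sP: "s \<notin> P ?a ?b"
  proof
    assume "s \<in> P ?a ?b"
    then have "v = s"
      using v_above P_refl by blast
    then show False
      using vs(3) P_ends [OF s(2) inV(3)] by blast
  qed
  have leg: "P s y \<inter> (set ?p1 \<union> set ?p2 \<union> P ?a ?b) \<subseteq> {y}"
    if y: "y \<in> leaves V ET" "v \<notin> P s y" for y
  proof -
    have "P s y \<inter> leaves V ET \<subseteq> {y}"
      using leaf_in_P [OF _ s(2) leaf_V [OF y(1)]] s(3) by blast
    moreover have "P s y \<inter> P ?a ?b = {}"
      using v_above P_split(1) [OF s(2) leaf_V [OF y(1)]] y(2) by blast
    ultimately show ?thesis
      using p1 p2 by blast
  qed
  \<comment> \<open>The foot of the third leg is the vertex where the paths from \<open>s\<close> to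
    \<open>b p\<close> and \<open>b q\<close> part.\<close>
  obtain w where w: "w \<in> P s ?a" "w \<in> P ?a ?b" "w \<in> P s ?b"
    using median [OF s(2) inV(1,2)] by metis
  have wV: "w \<in> V"
    using w P_subset inV by blast
  have w_ne: "w \<notin> {?a, ?b}"
    using leaf_in_P [OF leaf(1) s(2) inV(2)] leaf_in_P [OF leaf(2) s(2) inV(1)] w ne s(3) leaf by auto
  then have w_leaf: "w \<notin> leaves V ET"
    using p3 w by blast
  have "P s w \<inter> P ?a ?b \<subseteq> {w}"
    using P_split(1) [OF inV(1,2) w(2)] P_split(2) [OF s(2) inV(1) w(1)]
      P_split(2) [OF s(2) inV(2) w(3)] P_sym [OF inV(1) wV] by blast
  moreover have "P s w \<inter> leaves V ET = {}"
    using leaf_in_P [OF _ s(2) wV] s(3) w_leaf by blast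
  ultimately have leg3: "P s w \<inter> (set ?p1 \<union> set ?p2 \<union> P ?a ?b) \<subseteq> {w}"
    using p1 p2 by blast
  have T: "is_path E s (tpath ET s y) y" if "y \<in> V" for y
    using tpath [OF s(2) that] graph(3) by (auto intro: is_path_mono)
  show False
  proof (rule plane_drawing.no_K33_subdivision [OF D, of ?a ?p1 ?b ?p2 "tpath ET ?a ?b" "b j" "b 0" w
        s "tpath ET s (b j)" "tpath ET s (b 0)" "tpath ET s w"])
    show "b j \<in> set ?p1" "b 0 \<in> set ?p2"
      using pq by auto
    show "set ?p1 \<inter> P ?a ?b \<subseteq> {?a, ?b}" "set ?p2 \<inter> P ?a ?b \<subseteq> {?a, ?b}"
      using p1 p2 p3 by blast+
    show "s \<notin> set ?p1 \<union> set ?p2 \<union> P ?a ?b"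
      using sP p1 p2 s(3) by blast
    show "P s (b j) \<inter> (set ?p1 \<union> set ?p2 \<union> P ?a ?b) \<subseteq> {b j}"
         "P s (b 0) \<inter> (set ?p1 \<union> set ?p2 \<union> P ?a ?b) \<subseteq> {b 0}"
      using leg leaf vs by blast+
  qed (use path1 path2 path3 p12 ne w w_ne leg3 T inV wV in simp_all)
qed

end

section \<open>Intersections of the L-shapes\<close>

text \<open>The disjuncts are vertical against vertical, the two mixed pairs, and horizontal against
  horizontal. Collinear segments that meet do so at the larger of their two lower or left
  ends.\<close>

lemma L_shape_meet_iff:
  "L_shape ((x1, x2), (y1, y2)) \<inter> L_shape ((u1, u2), (v1, v2)) \<noteq> {} \<longleftrightarrow>
     (x1 = u1 \<and> max y1 v1 \<le> min y2 v2) \<or>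
     (x1 \<in> {u1..u2} \<and> v1 \<in> {y1..y2}) \<or>
     (u1 \<in> {x1..x2} \<and> y1 \<in> {v1..v2}) \<or>
     (y1 = v1 \<and> max x1 u1 \<le> min x2 u2)" (is "?L \<longleftrightarrow> ?R")
proof
  assume ?L
  then obtain x y where "(x, y) \<in> L_shape ((x1, x2), (y1, y2))" "(x, y) \<in> L_shape ((u1, u2), (v1, v2))"
    by fast
  then show ?R
    by auto
next
  assume ?R
  then have "(x1, max y1 v1) \<in> L_shape ((x1, x2), (y1, y2)) \<inter> L_shape ((u1, u2), (v1, v2)) \<or>
    (x1, v1) \<in> L_shape ((x1, x2), (y1, y2)) \<inter> L_shape ((u1, u2), (v1, v2)) \<or>
    (u1, y1) \<in> L_shape ((x1, x2), (y1, y2)) \<inter> L_shape ((u1, u2), (v1, v2)) \<or>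
    (max x1 u1, y1) \<in> L_shape ((x1, x2), (y1, y2)) \<inter> L_shape ((u1, u2), (v1, v2))"
    by auto
  then show ?L
    by blast
qed

section \<open>Coordinates of the shapes\<close>

context rooted_tuc
begin

text \<open>The abscissa of \<open>b j\<close>, increasing in the order \<open>b 1\<close>,
  \<open>b 0\<close>, \<open>b 2\<close>, ..., \<open>b (k - 1)\<close>.\<close>

definition X :: "nat \<Rightarrow> real" where "X j = (if j = 0 then 3/2 else real j)"

abbreviation ht :: "'a \<Rightarrow> nat" where "ht \<equiv> height ET s"

abbreviation h :: nat where "h \<equiv> tree_height V ET s"

lemma leaf_index_b: "j < k \<Longrightarrow> leaf_index cs i (b j) = j"
  unfolding leaf_index_def using b_inj by (intro the_equality) (auto simp: b_def)

lemma leaf_box_b: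
  assumes "j < k"
  shows "leaf_box V ET cs s i (b j) =
    ((X j, if j = 0 then real k - 1 else real j + 1),
     (if j = 0 \<or> j = k - 1 then 0 else 1, real h - real (ht (b j)) + 2))"
proof -
  \<comment> \<open>By \<open>k \<ge> 3\<close> the indices 0, 1 and \<open>k - 1\<close> are
    distinct, so the case distinction of \<open>leaf_box\<close> collapses.\<close>
  have "real (k - 1) = real k - 1" "k - 1 \<noteq> 0" "k - 1 \<noteq> 1"
    using k by (simp_all only: of_nat_diff)
  then show ?thesis
    unfolding leaf_box_def leaf_index_b [OF assms] Let_def X_def by (auto simp del: One_nat_def)
qed

lemma leaf_x_b: "j < k \<Longrightarrow> leaf_x V ET cs s i (b j) = X j"
  unfolding leaf_x_def leaf_box_b by simp

definition lo :: "'a \<Rightarrow> real" where "lo v = Min (leaf_x V ET cs s i ` below v)"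

definition hi :: "'a \<Rightarrow> real" where "hi v = Max (leaf_x V ET cs s i ` below v)"

text \<open>It drops by 1 per level, so the vertical segment of an inner vertex, of length 1, ends
  exactly at the height of its parent's horizontal segment.\<close>

definition base :: "'a \<Rightarrow> real" where "base v = real h - real (ht v) + 1"

lemma inner_box: "inner_box V ET cs s i v = ((lo v, hi v), (base v, base v + 1))"
  by (simp add: inner_box_def lo_def hi_def base_def below_def Let_def)

lemma L_rep_eq:
  "L_rep V ET cs r i u =
     L_shape (if u \<in> leaves V ET then leaf_box V ET cs s i u else ((lo u, hi u), (base u, base u + 1)))"
  by (simp add: L_rep_def Let_def graph(4) inner_box flip: s_def)

lemma X_inj: "X p = X q \<Longrightarrow> p = q"
proof -
  assume "X p = X q"
  moreover have "real j \<noteq> 3/2" for j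
  proof
    assume "real j = 3/2"
    then have "real (2 * j) = real 3"
      by simp
    then have "2 * j = 3"
      by (simp only: of_nat_eq_iff)
    then show False
      by presburger
  qed
  ultimately show "p = q"
    by (auto simp: X_def split: if_splits)
qed

lemma finite_below: "finite (below v)"
  using finite_V by (auto simp: below_iff leaves_def intro: finite_subset)

lemma below_ne:
  assumes "v \<in> V"
  shows "below v \<noteq> {}"
proof -
  have "V \<noteq> {s}"
    using b01 by auto
  then show ?thesis
    using descendant_leaf [OF s(2) assms] by (metis below_iff empty_iff)
qed

lemma lo_hi:
  assumes "v \<in> V"
  obtains p q where "p < k" "q < k" "b p \<in> below v" "b q \<in> below v" "lo v = X p" "hi v = X q"
proof -
  have fin: "finite (leaf_x V ET cs s i ` below v)" "leaf_x V ET cs s i ` below v \<noteq> {}"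
    using finite_below below_ne [OF assms] by auto
  have ex: "\<exists>p<k. b p \<in> below v \<and> z = X p" if z: "z \<in> leaf_x V ET cs s i ` below v" for z
  proof -
    obtain l where l: "l \<in> below v" "z = leaf_x V ET cs s i l"
      using z by blast
    then obtain p where "p < k" "l = b p"
      using leaves_b below_iff by auto
    then show ?thesis
      using l leaf_x_b by auto
  qed
  show ?thesis
    using that ex [OF Min_in [OF fin]] ex [OF Max_in [OF fin]] unfolding lo_def hi_def by blast
qed

lemma in_range: "j < k \<Longrightarrow> b j \<in> below v \<Longrightarrow> X j \<in> {lo v..hi v}"
  using finite_below leaf_x_b [of j] unfolding lo_def hi_def atLeastAtMost_iff
  by (metis Max_ge Min_le finite_imageI imageI)

text \<open>This makes ranges of abscissae faithful to subtrees, despite the swap of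
  \<open>b 0\<close> and \<open>b 1\<close>. With \<open>b 1\<close> below \<open>v\<close> the
  range is a point; with \<open>b 0\<close> below \<open>v\<close> it is a point or misses only
  \<open>b 1\<close>; otherwise \<open>no_crossing\<close> applies.\<close>

lemma range_below:
  assumes v: "v \<in> V" and j: "j < k" "X j \<in> {lo v..hi v}"
  shows "b j \<in> below v"
proof (rule ccontr)
  assume nb: "b j \<notin> below v"
  obtain p q where pq: "p < k" "q < k" "b p \<in> below v" "b q \<in> below v" "lo v = X p" "hi v = X q"
    using lo_hi [OF v] .
  have v_ne: "v \<noteq> s"
    using nb P_ends [OF s(2)] b_leaf [OF j(1)] leaf_V by (auto simp: below_iff)
  have Xj: "X p \<le> X j" "X j \<le> X q"
    using j(2) pq by auto
  show False
  proof (cases "b 1 \<in> below v")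
    case True
    then have "p = 1" "q = 1"
      using below_b1 [OF True v_ne] pq b_inj k by (metis One_nat_def Suc_lessD numeral_3_eq_3 order_less_le_trans lessI)+
    then show False
      using Xj X_inj [of j 1] nb True by auto
  next
    case n1: False
    show False
    proof (cases "b 0 \<in> below v")
      case True
      show False
      proof (cases "p = 0 \<and> q = 0")
        case True
        then show False
          using Xj X_inj [of j 0] nb pq by auto
      next
        case False
        have "0 < k"
          using pq by linarith
        then obtain l where "l \<in> below v" "l \<noteq> b 0"
          using False pq b_inj [of p 0] b_inj [of q 0] by auto
        then have "b j = b 1"
          using below_b0 [OF True v_ne] b_leaf [OF j(1)] nb by blast
        then have "j = 1"
          using b_inj [of j 1] j(1) k by linarith
        moreover have "p \<noteq> 1"
          using n1 pq by auto
        \<comment> \<open>The abscissa 1 of \<open>b 1\<close> is the least of all, so it lies left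
          of the range of the other leaves.\<close>
        ultimately show False
          using Xj by (auto simp: X_def split: if_splits)
      qed
    next
      case False
      \<comment> \<open>Now \<open>p\<close> is at least 2, and from 2 on \<open>X\<close> agrees
        with the index.\<close>
      have "p \<noteq> 0" "p \<noteq> 1" "q \<noteq> 0" "q \<noteq> 1" "p \<noteq> j" "q \<noteq> j"
        using pq(3,4) n1 False nb by metis+
      moreover from this have "p < j" "j < q"
        using Xj by (auto simp: X_def split: if_splits)
      ultimately show False
        using no_crossing [OF v, of p j q] pq False nb by auto
    qed
  qed
qed

lemma h_ge: "v \<in> V \<Longrightarrow> ht v \<le> h"
  unfolding tree_height_def using finite_V by auto

lemma inner_below:
  assumes "v \<in> V" "v \<notin> leaves V ET" "l \<in> below v"
  shows "ht v < ht l" "l \<in> V"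
proof -
  have l: "l \<in> V" "v \<in> P s l" "v \<noteq> l"
    using assms leaf_V by (auto simp: below_iff)
  then show "ht v < ht l" "l \<in> V"
    using height_split [OF s(2) l(1,2)] height_pos [OF assms(1) l(1)] by auto
qed

section \<open>Adjacency against intersection, by kind of vertex\<close>

lemma inner_inner_iff:
  assumes u: "u \<in> V" "u \<notin> leaves V ET" and v: "v \<in> V" "v \<notin> leaves V ET" and ne: "u \<noteq> v"
  shows "{u, v} \<in> E \<longleftrightarrow> L_rep V ET cs r i u \<inter> L_rep V ET cs r i v \<noteq> {}"
proof -
  \<comment> \<open>The leftmost leaf below \<open>w\<close> is also a leaf below
    \<open>z\<close>.\<close>
  have mono: "lo w \<in> {lo z..hi z}" if zw: "z \<in> V" "w \<in> V" "z \<in> P s w" for z w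
  proof -
    obtain p where p: "p < k" "b p \<in> below w" "lo w = X p"
      using lo_hi [OF zw(2)] by metis
    then have "w \<in> P s (b p)" "b p \<in> leaves V ET" "b p \<in> V"
      using leaf_V by (auto simp: below_iff)
    then have "b p \<in> below z"
      using P_split(1) [OF s(2), of "b p" w] zw(3) by (auto simp: below_iff)
    then show ?thesis
      using in_range p by auto
  qed
  \<comment> \<open>\<open>lo w\<close> is the abscissa of a leaf below \<open>w\<close>. By
    \<open>range_below\<close> it is below \<open>z\<close> too, and two ancestors of one leaf are
    comparable.\<close>
  have comparable: "z \<in> P s w \<or> w \<in> P s z" if zw: "z \<in> V" "w \<in> V" "lo w \<in> {lo z..hi z}" for z w
  proof -
    obtain p where p: "p < k" "b p \<in> below w" "lo w = X p"
      using lo_hi [OF zw(2)] by metis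
    then have "b p \<in> below z"
      using range_below [OF zw(1) p(1)] zw(3) p(3) by simp
    then show ?thesis
      using p ancestors_linear [OF s(2), of "b p" z w] leaf_V by (auto simp: below_iff)
  qed
  have lohi: "lo z \<le> hi z" if "z \<in> V" for z
    using mono [OF that that] P_ends [OF s(2) that] by simp
  have E: "{u, v} \<in> E \<longleftrightarrow> {u, v} \<in> ET"
    using graph(3,5) u by blast
  show ?thesis
    unfolding E L_rep_eq using u(2) v(2)
  proof (simp only: if_False L_shape_meet_iff, intro iffI)
    assume "{u, v} \<in> ET"
    then have "u \<in> P s v \<and> ht v = Suc (ht u) \<or> v \<in> P s u \<and> ht u = Suc (ht v)"
      by (rule edge_ancestor [OF s(2)])
    then have "(lo v \<in> {lo u..hi u} \<and> base u = base v + 1) \<or> (lo u \<in> {lo v..hi v} \<and> base v = base u + 1)"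
      using mono u(1) v(1) by (auto simp: base_def)
    then show "lo u = lo v \<and> max (base u) (base v) \<le> min (base u + 1) (base v + 1) \<or>
      lo u \<in> {lo v..hi v} \<and> base v \<in> {base u..base u + 1} \<or>
      lo v \<in> {lo u..hi u} \<and> base u \<in> {base v..base v + 1} \<or>
      base u = base v \<and> max (lo u) (lo v) \<le> min (hi u) (hi v)"
      by auto
  next
    assume m: "lo u = lo v \<and> max (base u) (base v) \<le> min (base u + 1) (base v + 1) \<or>
      lo u \<in> {lo v..hi v} \<and> base v \<in> {base u..base u + 1} \<or>
      lo v \<in> {lo u..hi u} \<and> base u \<in> {base v..base v + 1} \<or>
      base u = base v \<and> max (lo u) (lo v) \<le> min (hi u) (hi v)"
    \<comment> \<open>For overlapping horizontal segments, the larger of the two left ends lies in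
      both ranges.\<close>
    then have "lo u \<in> {lo v..hi v} \<or> lo v \<in> {lo u..hi u}"
      using lohi [OF u(1)] lohi [OF v(1)] by auto
    then have "u \<in> P s v \<or> v \<in> P s u"
      using comparable u v by blast
    moreover have "base u \<le> base v + 1" "base v \<le> base u + 1"
      using m by auto
    then have "ht u \<le> Suc (ht v)" "ht v \<le> Suc (ht u)"
      by (auto simp: base_def)
    ultimately show "{u, v} \<in> ET"
    proof (elim disjE)
      assume uv: "u \<in> P s v"
      then have "ht v = Suc (ht u)"
        using height_split [OF s(2) v(1) uv] height_pos [OF u(1) v(1) ne] \<open>ht v \<le> Suc (ht u)\<close> by simp
      then show ?thesis
        using height_Suc_edge [OF s(2) v(1) uv] by simp
    next
      assume vu: "v \<in> P s u"
      then have "ht u = Suc (ht v)"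
        using height_split [OF s(2) u(1) vu] height_pos [OF v(1) u(1)] ne \<open>ht u \<le> Suc (ht v)\<close> by simp
      then show ?thesis
        using height_Suc_edge [OF s(2) u(1) vu] by (simp add: insert_commute)
    qed
  qed
qed

text \<open>The vertical segment of a leaf ends at the \<open>base\<close> of its parent. All other
  ancestors lie higher, and by \<open>range_below\<close> non-ancestors do not extend over its
  abscissa.\<close>

lemma leaf_inner_iff:
  assumes j: "j < k" and v: "v \<in> V" "v \<notin> leaves V ET"
  shows "{b j, v} \<in> E \<longleftrightarrow> L_rep V ET cs r i (b j) \<inter> L_rep V ET cs r i v \<noteq> {}"
proof -
  let ?l = "b j"
  have l: "?l \<in> leaves V ET" "?l \<in> V"
    using b_leaf [OF j] leaf_V by auto
  have E: "{?l, v} \<in> E \<longleftrightarrow> {v, ?l} \<in> ET"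
    using graph(3,5) v by (auto simp: insert_commute)
  have "ht v < h"
    using below_ne [OF v(1)] inner_below [OF v] h_ge by (meson all_not_in_conv order_less_le_trans)
  \<comment> \<open>Inner shapes thus stay above height 1, out of reach of the feet of the
    leaves.\<close>
  then have base: "base v \<ge> 2"
    by (simp add: base_def)
  obtain x2 y1 where box: "leaf_box V ET cs s i ?l = ((X j, x2), (y1, real h - real (ht ?l) + 2))" "y1 \<le> 1"
    using leaf_box_b [OF j] by auto
  have "{v, ?l} \<in> ET \<longleftrightarrow> ?l \<in> below v \<and> ht ?l \<le> Suc (ht v)"
  proof
    assume "{v, ?l} \<in> ET"
    then have "v \<in> P s ?l \<and> ht ?l = Suc (ht v) \<or> ?l \<in> P s v \<and> ht v = Suc (ht ?l)"
      by (rule edge_ancestor [OF s(2)])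
    moreover have "?l \<notin> P s v"
      using leaf_in_P [OF l(1) s(2) v(1)] s(3) v l(1) by metis
    ultimately show "?l \<in> below v \<and> ht ?l \<le> Suc (ht v)"
      using l by (simp add: below_iff)
  next
    assume *: "?l \<in> below v \<and> ht ?l \<le> Suc (ht v)"
    then have "ht ?l = Suc (ht v)"
      using inner_below(1) [OF v] by fastforce
    then show "{v, ?l} \<in> ET"
      using height_Suc_edge [OF s(2) l(2)] * by (auto simp: below_iff)
  qed
  also have "\<dots> \<longleftrightarrow> X j \<in> {lo v..hi v} \<and> base v \<le> real h - real (ht ?l) + 2"
  proof -
    have "?l \<in> below v \<longleftrightarrow> X j \<in> {lo v..hi v}"
      using in_range [OF j] range_below [OF v(1) j] by blast
    moreover have "ht ?l \<le> Suc (ht v) \<longleftrightarrow> base v \<le> real h - real (ht ?l) + 2"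
      unfolding base_def by linarith
    ultimately show ?thesis
      by (simp only:)
  qed
  also have "\<dots> \<longleftrightarrow> L_rep V ET cs r i ?l \<inter> L_rep V ET cs r i v \<noteq> {}"
  proof -
    have "lo v \<le> hi v"
    proof -
      obtain p where "p < k" "b p \<in> below v" "lo v = X p"
        using lo_hi [OF v(1)] by metis
      then show ?thesis
        using in_range [of p v] by simp
    qed
    then show ?thesis
      unfolding L_rep_eq if_P [OF l(1)] if_not_P [OF v(2)] box(1) L_shape_meet_iff
      using box(2) base by auto
  qed
  finally show ?thesis
    using E by blast
qed

text \<open>A foot at height 1 spans one unit and so meets only the next leaf, except that the foot
  of \<open>b 1\<close> also crosses \<open>b 0\<close>. At height 0 only \<open>b 0\<close> and
  \<open>b (k - 1)\<close> are present.\<close>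

lemma leaf_leaf_iff:
  assumes "p < q" "q < k"
  shows "{b p, b q} \<in> E \<longleftrightarrow> L_rep V ET cs r i (b p) \<inter> L_rep V ET cs r i (b q) \<noteq> {}"
proof -
  have pq: "p < k" "b p \<in> leaves V ET" "b q \<in> leaves V ET"
    using assms b_leaf by auto
  have "{b p, b q} \<in> E \<longleftrightarrow> {b p, b q} \<in> cycle_edges cs"
    using graph(3,5) pq by blast
  also have "\<dots> \<longleftrightarrow> q = Suc p \<or> p = 0 \<and> q = k - 1"
    using b_edge_iff assms .
  also have "\<dots> \<longleftrightarrow> L_rep V ET cs r i (b p) \<inter> L_rep V ET cs r i (b q) \<noteq> {}"
  proof -
    \<comment> \<open>Every vertical segment of a leaf thus reaches beyond height 1, where the feet
      of its neighbours arrive.\<close>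
    have top: "real h - real (ht (b t)) + 2 \<ge> 2" if "t < k" for t
      using h_ge [OF leaf_V [OF b_leaf [OF that]]] by simp
    define tp tq where "tp = real h - real (ht (b p)) + 2" and "tq = real h - real (ht (b q)) + 2"
    have "tp \<ge> 2" "tq \<ge> 2"
      using top pq(1) assms(2) by (simp_all add: tp_def tq_def)
    then show ?thesis
      unfolding L_rep_eq if_P [OF pq(2)] if_P [OF pq(3)] leaf_box_b [OF pq(1)] leaf_box_b [OF assms(2)]
        L_shape_meet_iff tp_def [symmetric] tq_def [symmetric]
      using assms k by (auto simp: X_def)
  qed
  finally show ?thesis .
qed

lemma valid_rep: "valid_VPG_rep V E (L_rep V ET cs r i)"
  unfolding valid_VPG_rep_def
proof (intro ballI impI)
  fix u v assume uv: "u \<in> V" "v \<in> V" "u \<noteq> v"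
  let ?L = "L_rep V ET cs r i"
  consider "u \<notin> leaves V ET" "v \<notin> leaves V ET"
    | p where "u = b p" "p < k" "v \<notin> leaves V ET"
    | q where "v = b q" "q < k" "u \<notin> leaves V ET"
    | p q where "u = b p" "v = b q" "p < q" "q < k"
    | p q where "u = b p" "v = b q" "q < p" "p < k"
  proof (cases "u \<in> leaves V ET"; cases "v \<in> leaves V ET")
    assume "u \<in> leaves V ET" "v \<in> leaves V ET"
    then obtain p q where "u = b p" "v = b q" "p < k" "q < k"
      using leaves_b by auto
    then show thesis
      using that(4,5) [of p q] uv(3) by (cases p q rule: linorder_cases) auto
  qed (use leaves_b that(1-3) in auto)
  then show "{u, v} \<in> E \<longleftrightarrow> ?L u \<inter> ?L v \<noteq> {}"
  proof cases
    case 1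
    then show ?thesis
      using inner_inner_iff uv by blast
  next
    case 2
    then show ?thesis
      using leaf_inner_iff uv by blast
  next
    case (3 q)
    then show ?thesis
      using leaf_inner_iff [of q u] uv by (simp add: insert_commute Int_commute)
  next
    case 4
    then show ?thesis
      using leaf_leaf_iff by blast
  next
    case (5 p q)
    then show ?thesis
      using leaf_leaf_iff [of q p] by (simp add: insert_commute Int_commute)
  qed
qed

end

theorem claim1:
  fixes V :: "'a set" and E ET :: "'a set set" and cs :: "'a list" and r :: 'a and i :: nat
  assumes "tree_union_cycle V E ET cs"
    and not_wheel: "\<not> is_singleton (V - set cs)"
    and "r \<in> V - set cs"
    and "i < length cs"
    and "good_pair ET cs i"
    and "root_admissible ET cs r i"
  shows "valid_VPG_rep V E (L_rep V ET cs r i)"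
proof -
  interpret rooted_tuc V E ET cs r i
    using assms by unfold_locales
  show ?thesis
    by (rule valid_rep)
qed

end
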